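(* Let $X$ be a Tychonoff space which is a $\mu$-space. Then the free locally convex space $L(X)$ over $X$ has the Grothendieck property if and only if every compact subset of $X$ is finite.
   Context: Locally convex spaces (lcs) are real and Hausdorff; Tychonoff means completely regular and Hausdorff. The free locally convex space over a Tychonoff space $X$ is an lcs $L(X)$ with a continuous map $i:X\to L(X)$ such that for every continuous map $f$ from $X$ to an lcs $E$ there is a unique continuous linear operator $\bar f:L(X)\to E$ with $f=\bar f\circ i$. It exists and is essentially unique, and $i$ is a topological embedding whose image is a Hamel basis of $L(X)$. A subset $A$ of $X$ is functionally bounded in $X$ if every continuous $f:X\to\mathbb{R}$ is bounded on $A$; $X$ is a $\mu$-space if every functionally bounded subset of $X$ has compact closure. For an lcs $E$ with dual $E'$, $E'_\beta$ denotes $E'$ with the strong topology $\beta(E',E)$ (uniform convergence on bounded subsets of $E$). $E$ has the Grothendieck property if every sequence in $E'$ that is convergent in the weak-$*$ topology $\sigma(E',E)$ is convergent in the weak topology of the lcs $E'_\beta$. *)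

theory Defs
  imports "HOL-Analysis.Analysis" "HOL-Library.Function_Algebras"
begin

text \<open>Pointwise vector space structure on real-vector-valued functions.\<close>

instantiation "fun" :: (type, real_vector) real_vector
begin

definition scaleR_fun :: "real \<Rightarrow> ('a \<Rightarrow> 'b) \<Rightarrow> 'a \<Rightarrow> 'b"
  where "scaleR_fun c f = (\<lambda>x. c *\<^sub>R f x)"

instance
  by standard (auto simp: scaleR_fun_def fun_eq_iff scaleR_add_right scaleR_add_left)

end

text \<open>
  A locally convex space is given by its topology alone: the vector space operations are those
  of the ambient type, and the underlying vector space is the topological carrier, which has to
  be a linear subspace.
\<close>

definition lcs :: "'v::real_vector topology \<Rightarrow> bool" where
  "lcs E \<longleftrightarrow>
     subspace (topspace E) \<and>
     Hausdorff_space E \<and>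
     continuous_map (prod_topology E E) E (\<lambda>(x, y). x + y) \<and>
     continuous_map (prod_topology euclideanreal E) E (\<lambda>(c, x). c *\<^sub>R x) \<and>
     (\<forall>U. openin E U \<and> 0 \<in> U \<longrightarrow> (\<exists>V. openin E V \<and> convex V \<and> 0 \<in> V \<and> V \<subseteq> U))"

definition linear_on_set :: "'v::real_vector set \<Rightarrow> ('v \<Rightarrow> 'w::real_vector) \<Rightarrow> bool" where
  "linear_on_set S f \<longleftrightarrow>
     (\<forall>x\<in>S. \<forall>y\<in>S. f (x + y) = f x + f y) \<and> (\<forall>c. \<forall>x\<in>S. f (c *\<^sub>R x) = c *\<^sub>R f x)"

definition continuous_linear ::
    "'v::real_vector topology \<Rightarrow> 'w::real_vector topology \<Rightarrow> ('v \<Rightarrow> 'w) \<Rightarrow> bool" where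
  "continuous_linear E F f \<longleftrightarrow> linear_on_set (topspace E) f \<and> continuous_map E F f"

text \<open>
  The universal property of the free locally convex space. HOL cannot quantify over types inside
  a formula, so the test spaces \<open>E\<close> range over all locally convex topologies on all linear
  subspaces of the vector space \<open>('a + 'l) \<Rightarrow> real\<close>. This is no restriction: lemma
  \<open>free_lcs_universal\<close> below derives the universal property for locally convex spaces over an
  arbitrary type. Membership in \<open>extensional (topspace L)\<close> only makes the total HOL function
  representing an operator on \<open>topspace L\<close> unique.
\<close>

definition free_lcs ::
    "'a topology \<Rightarrow> 'l::real_vector topology \<Rightarrow> ('a \<Rightarrow> 'l) \<Rightarrow> bool" where
  "free_lcs X L i \<longleftrightarrow>
     lcs L \<and> continuous_map X L i \<and>
     (\<forall>(E :: ('a + 'l \<Rightarrow> real) topology) f. lcs E \<and> continuous_map X E f \<longrightarrow>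
        (\<exists>!g. g \<in> extensional (topspace L) \<and> continuous_linear L E g \<and>
              (\<forall>x\<in>topspace X. f x = g (i x))))"

definition functionally_bounded_in :: "'a topology \<Rightarrow> 'a set \<Rightarrow> bool" where
  "functionally_bounded_in X A \<longleftrightarrow>
     A \<subseteq> topspace X \<and> (\<forall>f. continuous_map X euclideanreal f \<longrightarrow> bounded (f ` A))"

definition mu_space :: "'a topology \<Rightarrow> bool" where
  "mu_space X \<longleftrightarrow> (\<forall>A. functionally_bounded_in X A \<longrightarrow> compactin X (X closure_of A))"

definition Tychonoff_space :: "'a topology \<Rightarrow> bool" where
  "Tychonoff_space X \<longleftrightarrow> completely_regular_space X \<and> Hausdorff_space X"

text \<open>
  The dual space, as a linear subspace of the type of all functions into the reals: functionals
  are extended by \<open>0\<close> outside of the carrier.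
\<close>

definition dual_space :: "'v::real_vector topology \<Rightarrow> ('v \<Rightarrow> real) set" where
  "dual_space E =
     {\<phi>. continuous_linear E euclideanreal \<phi> \<and> (\<forall>x. x \<notin> topspace E \<longrightarrow> \<phi> x = 0)}"

definition lcs_bounded :: "'v::real_vector topology \<Rightarrow> 'v set \<Rightarrow> bool" where
  "lcs_bounded E B \<longleftrightarrow>
     B \<subseteq> topspace E \<and>
     (\<forall>U. openin E U \<and> 0 \<in> U \<longrightarrow> (\<exists>r>0. \<forall>s\<ge>r. B \<subseteq> (\<lambda>x. s *\<^sub>R x) ` U))"

text \<open>The coarsest topology on \<open>S\<close> making all functions in a nonempty family continuous.\<close>

definition initial_topology :: "'v set \<Rightarrow> ('v \<Rightarrow> real) set \<Rightarrow> 'v topology" where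
  "initial_topology S \<Phi> = topology_generated_by {{x \<in> S. \<phi> x \<in> U} | \<phi> U. \<phi> \<in> \<Phi> \<and> open U}"

definition weak_topology :: "'v::real_vector topology \<Rightarrow> 'v topology" where
  "weak_topology E = initial_topology (topspace E) (dual_space E)"

definition weak_star_topology :: "'v::real_vector topology \<Rightarrow> ('v \<Rightarrow> real) topology" where
  "weak_star_topology E = initial_topology (dual_space E) ((\<lambda>x \<phi>. \<phi> x) ` topspace E)"

text \<open>
  The topology of uniform convergence on bounded sets. Finite unions of bounded sets are bounded,
  so the sets of functionals \<open>\<epsilon>\<close>-close to \<open>\<phi>\<close> on a bounded set form a neighbourhood base
  at \<open>\<phi>\<close>.
\<close>

definition strong_open :: "'v::real_vector topology \<Rightarrow> ('v \<Rightarrow> real) set \<Rightarrow> bool" where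
  "strong_open E U \<longleftrightarrow>
     U \<subseteq> dual_space E \<and>
     (\<forall>\<phi>\<in>U. \<exists>B \<epsilon>. lcs_bounded E B \<and> 0 < \<epsilon> \<and>
        {\<psi> \<in> dual_space E. \<forall>x\<in>B. \<bar>\<psi> x - \<phi> x\<bar> < \<epsilon>} \<subseteq> U)"

definition strong_dual :: "'v::real_vector topology \<Rightarrow> ('v \<Rightarrow> real) topology" where
  "strong_dual E = topology (strong_open E)"

definition Grothendieck_property :: "'v::real_vector topology \<Rightarrow> bool" where
  "Grothendieck_property E \<longleftrightarrow>
     (\<forall>\<phi> :: nat \<Rightarrow> 'v \<Rightarrow> real.
        range \<phi> \<subseteq> dual_space E \<and> (\<exists>l. limitin (weak_star_topology E) \<phi> l sequentially) \<longrightarrow>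
        (\<exists>l. limitin (weak_topology (strong_dual E)) \<phi> l sequentially))"

subsection \<open>Sanity checks\<close>

lemma lcs_bounded_Un:
  assumes "lcs_bounded E A" "lcs_bounded E B"
  shows "lcs_bounded E (A \<union> B)"
  unfolding lcs_bounded_def
proof (intro conjI allI impI)
  show "A \<union> B \<subseteq> topspace E" using assms by (auto simp: lcs_bounded_def)
  fix U assume U: "openin E U \<and> 0 \<in> U"
  obtain r where r: "r > 0" "\<forall>s\<ge>r. A \<subseteq> (\<lambda>x. s *\<^sub>R x) ` U"
    using assms(1) U unfolding lcs_bounded_def by blast
  obtain r' where r': "r' > 0" "\<forall>s\<ge>r'. B \<subseteq> (\<lambda>x. s *\<^sub>R x) ` U"
    using assms(2) U unfolding lcs_bounded_def by blast
  show "\<exists>r>0. \<forall>s\<ge>r. A \<union> B \<subseteq> (\<lambda>x. s *\<^sub>R x) ` U"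
    by (rule exI[of _ "max r r'"]) (use r r' in auto)
qed

lemma istopology_strong_open: "istopology (strong_open E)"
  unfolding istopology_def
proof (intro conjI allI impI)
  fix S T assume S: "strong_open E S" and T: "strong_open E T"
  show "strong_open E (S \<inter> T)"
    unfolding strong_open_def
  proof (intro conjI ballI)
    show "S \<inter> T \<subseteq> dual_space E" using S by (auto simp: strong_open_def)
    fix \<phi> assume \<phi>: "\<phi> \<in> S \<inter> T"
    obtain B \<epsilon> where B: "lcs_bounded E B" "0 < \<epsilon>"
      "{\<psi> \<in> dual_space E. \<forall>x\<in>B. \<bar>\<psi> x - \<phi> x\<bar> < \<epsilon>} \<subseteq> S"
      using S \<phi> unfolding strong_open_def by blast
    obtain B' \<epsilon>' where B': "lcs_bounded E B'" "0 < \<epsilon>'"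
      "{\<psi> \<in> dual_space E. \<forall>x\<in>B'. \<bar>\<psi> x - \<phi> x\<bar> < \<epsilon>'} \<subseteq> T"
      using T \<phi> unfolding strong_open_def by blast
    show "\<exists>B \<epsilon>. lcs_bounded E B \<and> 0 < \<epsilon> \<and>
        {\<psi> \<in> dual_space E. \<forall>x\<in>B. \<bar>\<psi> x - \<phi> x\<bar> < \<epsilon>} \<subseteq> S \<inter> T"
      using B B' lcs_bounded_Un[OF B(1) B'(1)]
      by (intro exI[of _ "B \<union> B'"] exI[of _ "min \<epsilon> \<epsilon>'"]) auto
  qed
next
  fix K assume K: "\<forall>S\<in>K. strong_open E S"
  show "strong_open E (\<Union>K)"
    unfolding strong_open_def
  proof (intro conjI ballI)
    show "\<Union>K \<subseteq> dual_space E" using K by (auto simp: strong_open_def)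
    fix \<phi> assume "\<phi> \<in> \<Union>K"
    then obtain S where S: "S \<in> K" "\<phi> \<in> S" by blast
    then obtain B \<epsilon> where "lcs_bounded E B" "0 < \<epsilon>"
      "{\<psi> \<in> dual_space E. \<forall>x\<in>B. \<bar>\<psi> x - \<phi> x\<bar> < \<epsilon>} \<subseteq> S"
      using K unfolding strong_open_def by blast
    then show "\<exists>B \<epsilon>. lcs_bounded E B \<and> 0 < \<epsilon> \<and>
        {\<psi> \<in> dual_space E. \<forall>x\<in>B. \<bar>\<psi> x - \<phi> x\<bar> < \<epsilon>} \<subseteq> \<Union>K"
      using S by blast
  qed
qed

lemma openin_strong_dual: "openin (strong_dual E) U \<longleftrightarrow> strong_open E U"
  by (simp add: strong_dual_def istopology_strong_open topology_inverse')

lemma topspace_strong_dual: "topspace (strong_dual E) = dual_space E"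
proof -
  have "lcs_bounded E {}" by (auto simp: lcs_bounded_def intro: exI[of _ 1])
  then have "strong_open E (dual_space E)"
    by (auto simp: strong_open_def intro!: exI[of _ "{}"] exI[of _ 1])
  then show ?thesis
    unfolding topspace_def openin_strong_dual by (auto simp: strong_open_def)
qed

lemma topspace_initial_topology:
  assumes "\<Phi> \<noteq> {}"
  shows "topspace (initial_topology S \<Phi>) = S"
proof -
  have "\<Union>{{x \<in> S. \<phi> x \<in> U} | \<phi> U. \<phi> \<in> \<Phi> \<and> open U} = S"
    using assms by (auto intro!: exI[of _ "UNIV"])
  then show ?thesis
    unfolding initial_topology_def topology_generated_by_topspace .
qed

lemma zero_in_dual_space: "0 \<in> dual_space E"
  by (auto simp: dual_space_def continuous_linear_def linear_on_set_def zero_fun_def)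

lemma topspace_weak_topology: "topspace (weak_topology E) = topspace E"
  using zero_in_dual_space topspace_initial_topology unfolding weak_topology_def by blast

lemma topspace_weak_star_topology:
  "lcs E \<Longrightarrow> topspace (weak_star_topology E) = dual_space E"
  unfolding weak_star_topology_def
  by (rule topspace_initial_topology) (auto simp: lcs_def dest: subspace_0)

lemma lcs_pullback:
  fixes E :: "'v::real_vector topology" and h :: "'w::real_vector \<Rightarrow> 'v"
  assumes E: "lcs E" and S: "subspace S" and lin: "linear_on_set S h" and inj: "inj_on h S"
    and sub: "h ` S \<subseteq> topspace E"
  shows "lcs (pullback_topology S h E)"
proof -
  let ?P = "pullback_topology S h E"
  have top: "topspace ?P = S" using sub by (auto simp: topspace_pullback_topology)
  have ch: "continuous_map ?P E h"
    using continuous_map_pullback[of E E id S h] by simp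
  have add: "h (x + y) = h x + h y" if "x \<in> S" "y \<in> S" for x y
    using lin that by (auto simp: linear_on_set_def)
  have scale: "h (c *\<^sub>R x) = c *\<^sub>R h x" if "x \<in> S" for c x
    using lin that by (auto simp: linear_on_set_def)
  have h0: "h 0 = 0" using scale[of 0 0] S by (simp add: subspace_0)
  have into: "continuous_map Z ?P k"
    if "continuous_map Z E (h \<circ> k)" "\<And>z. z \<in> topspace Z \<Longrightarrow> k z \<in> S"
    for Z :: "'z topology" and k
    using that by (intro continuous_map_pullback') auto
  have "Hausdorff_space ?P"
    by (rule Hausdorff_space_injective_preimage[OF _ ch]) (use E inj top in \<open>auto simp: lcs_def\<close>)
  moreover have "continuous_map (prod_topology ?P ?P) ?P (\<lambda>(x, y). x + y)"
  proof (rule into)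
    have "continuous_map (prod_topology ?P ?P) (prod_topology E E) (\<lambda>(x, y). (h x, h y))"
      using ch by (simp add: continuous_map_prod_top)
    then have "continuous_map (prod_topology ?P ?P) E ((\<lambda>(x, y). x + y) \<circ> (\<lambda>(x, y). (h x, h y)))"
      using E unfolding lcs_def by (blast intro: continuous_map_compose)
    then show "continuous_map (prod_topology ?P ?P) E (h \<circ> (\<lambda>(x, y). x + y))"
      by (rule continuous_map_eq) (auto simp: top add)
  qed (auto simp: top S subspace_add)
  moreover have "continuous_map (prod_topology euclideanreal ?P) ?P (\<lambda>(c, x). c *\<^sub>R x)"
  proof (rule into)
    have "continuous_map (prod_topology euclideanreal ?P) (prod_topology euclideanreal E)
        (\<lambda>(c, x). (id c, h x))"
      using ch by (subst continuous_map_prod_top) auto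
    then have "continuous_map (prod_topology euclideanreal ?P) E
        ((\<lambda>(c, x). c *\<^sub>R x) \<circ> (\<lambda>(c, x). (id c, h x)))"
      using E unfolding lcs_def by (blast intro: continuous_map_compose)
    then show "continuous_map (prod_topology euclideanreal ?P) E (h \<circ> (\<lambda>(c, x). c *\<^sub>R x))"
      by (rule continuous_map_eq) (auto simp: top scale)
  qed (auto simp: top S subspace_scale)
  moreover have "\<exists>V. openin ?P V \<and> convex V \<and> 0 \<in> V \<and> V \<subseteq> U"
    if U: "openin ?P U" "0 \<in> U" for U
  proof -
    obtain W where W: "openin E W" "U = h -` W \<inter> S"
      using U(1) by (auto simp: openin_pullback_topology)
    have "0 \<in> W" using W U(2) h0 by auto
    then obtain V where V: "openin E V" "convex V" "0 \<in> V" "V \<subseteq> W"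
      using E W(1) unfolding lcs_def by blast
    have "convex (h -` V \<inter> S)"
      unfolding convex_def
    proof (intro ballI allI impI)
      fix x y u v assume *: "x \<in> h -` V \<inter> S" "y \<in> h -` V \<inter> S" "0 \<le> (u::real)" "0 \<le> v" "u + v = 1"
      then have "h (u *\<^sub>R x + v *\<^sub>R y) = u *\<^sub>R h x + v *\<^sub>R h y"
        using add[of "u *\<^sub>R x" "v *\<^sub>R y"] scale S by (auto simp: subspace_scale)
      then show "u *\<^sub>R x + v *\<^sub>R y \<in> h -` V \<inter> S"
        using * V(2) S by (auto simp: convex_def subspace_scale subspace_add)
    qed
    then show ?thesis
      using V W h0 S by (intro exI[of _ "h -` V \<inter> S"]) (auto simp: openin_pullback_topology subspace_0)
  qed
  ultimately show ?thesis
    unfolding lcs_def top using S by blast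
qed

lemma lcs_transport:
  fixes E :: "'e::real_vector topology" and k :: "'k \<Rightarrow> 'e"
  assumes E: "lcs E" and k: "k ` I \<subseteq> topspace E"
  obtains F :: "('k \<Rightarrow> real) topology" and p q where
    "lcs F" "continuous_linear F E q" "p ` span (k ` I) = topspace F"
    "continuous_linear (subtopology E (span (k ` I))) F p"
    "\<And>v. v \<in> span (k ` I) \<Longrightarrow> q (p v) = v"
proof -
  let ?S = "span (k ` I)"
  have SE: "?S \<subseteq> topspace E"
    using E k by (simp add: lcs_def span_minimal)
  obtain B where B: "B \<subseteq> k ` I" "independent B" "k ` I \<subseteq> span B"
    using maximal_independent_subset[of "k ` I"] by blast
  have SB: "?S = span B"
    using B by (meson antisym span_mono span_minimal subspace_span)
  define K where "K = inv_into I k ` B"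
  have kK: "b \<in> k ` K" if "b \<in> B" for b
    unfolding K_def using that B(1) by (metis f_inv_into_f image_eqI subsetD)
  define p where "p v = (\<lambda>x. if x \<in> K then representation B v (k x) else 0)" for v
  have lin: "linear_on_set ?S p"
    unfolding linear_on_set_def p_def SB
    by (auto simp: fun_eq_iff scaleR_fun_def representation_add[OF B(2)] representation_scale[OF B(2)])
  have inj: "inj_on p ?S"
  proof (rule inj_onI)
    fix v w assume vw: "v \<in> ?S" "w \<in> ?S" "p v = p w"
    have "representation B v b = representation B w b" for b
    proof (cases "b \<in> B")
      case True
      then obtain x where x: "x \<in> K" "b = k x" using kK by blast
      then show ?thesis using fun_cong[OF vw(3), of x] by (simp add: p_def)
    next
      case False
      then show ?thesis using representation_ne_zero by metis
    qed
    then have "representation B v = representation B w" by auto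
    then show "v = w"
      using sum_nonzero_representation_eq[OF B(2)] vw(1,2) unfolding SB by metis
  qed
  define q where "q = inv_into ?S p"
  have qp: "q (p v) = v" if "v \<in> ?S" for v
    using that inj by (simp add: q_def)
  have padd: "p (x + y) = p x + p y" and pscale: "p (c *\<^sub>R x) = c *\<^sub>R p x"
    if "x \<in> ?S" "y \<in> ?S" for x y c
    using lin that by (auto simp: linear_on_set_def)
  have sub: "subspace (p ` ?S)"
    unfolding subspace_def
  proof (intro conjI ballI allI)
    have "p 0 = 0" using pscale[of 0 0 0] by (simp add: span_zero)
    then show "0 \<in> p ` ?S" using span_zero by (intro image_eqI[of _ _ 0]) auto
  next
    fix u v assume "u \<in> p ` ?S" "v \<in> p ` ?S"
    then obtain x y where "x \<in> ?S" "y \<in> ?S" "u = p x" "v = p y" by blast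
    then show "u + v \<in> p ` ?S"
      by (intro image_eqI[of _ _ "x + y"]) (auto simp: padd span_add)
  next
    fix c u assume "u \<in> p ` ?S"
    then obtain x where "x \<in> ?S" "u = p x" by blast
    then show "c *\<^sub>R u \<in> p ` ?S"
      by (intro image_eqI[of _ _ "c *\<^sub>R x"]) (auto simp: pscale span_scale)
  qed
  have qlin: "linear_on_set (p ` ?S) q"
    unfolding linear_on_set_def
  proof (intro conjI ballI allI)
    fix u v assume "u \<in> p ` ?S" "v \<in> p ` ?S"
    then obtain x y where "x \<in> ?S" "y \<in> ?S" "u = p x" "v = p y" by blast
    then show "q (u + v) = q u + q v" by (simp add: padd[symmetric] qp span_add)
  next
    fix c u assume "u \<in> p ` ?S"
    then obtain x where "x \<in> ?S" "u = p x" by blast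
    then show "q (c *\<^sub>R u) = c *\<^sub>R q u" by (simp add: pscale[symmetric] qp span_scale)
  qed
  have qinj: "inj_on q (p ` ?S)" using qp by (auto intro!: inj_onI)
  have qsub: "q ` (p ` ?S) \<subseteq> topspace E" using qp SE by auto
  define F where "F = pullback_topology (p ` ?S) q E"
  have topF: "topspace F = p ` ?S"
    unfolding F_def topspace_pullback_topology using qsub by auto
  have cq: "continuous_map F E q"
    unfolding F_def using continuous_map_pullback[of E E id "p ` ?S" q] by simp
  have "continuous_map (subtopology E ?S) E (q \<circ> p)"
    by (rule continuous_map_eq[of _ _ id]) (auto simp: qp continuous_map_from_subtopology)
  then have cp: "continuous_map (subtopology E ?S) F p"
    unfolding F_def by (intro continuous_map_pullback') auto
  have topS: "topspace (subtopology E ?S) = ?S" using SE by auto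
  show ?thesis
  proof (rule that)
    show "lcs F" unfolding F_def by (rule lcs_pullback[OF E sub qlin qinj qsub])
    show "continuous_linear F E q" using cq qlin by (simp add: continuous_linear_def topF)
    show "p ` ?S = topspace F" by (simp add: topF)
    show "continuous_linear (subtopology E ?S) F p"
      using cp lin by (simp add: continuous_linear_def topS del: topspace_subtopology)
    show "\<And>v. v \<in> ?S \<Longrightarrow> q (p v) = v" by (rule qp)
  qed
qed

lemma continuous_linear_compose:
  assumes "continuous_linear E F f" "continuous_linear F G g"
  shows "continuous_linear E G (g \<circ> f)"
  using assms continuous_map_compose[of E F f G g] continuous_map_image_subset_topspace[of E F f]
  by (auto simp: continuous_linear_def linear_on_set_def image_subset_iff)

lemma continuous_linear_restrict:
  assumes "lcs E" "continuous_linear E F f"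
  shows "continuous_linear E F (restrict f (topspace E))"
  using assms continuous_map_eq[of E F f "restrict f (topspace E)"]
  by (auto simp: continuous_linear_def linear_on_set_def lcs_def subspace_add subspace_scale)

lemma lcs_continuous_map_diff:
  assumes E: "lcs E" and "continuous_map Z E f" "continuous_map Z E g"
  shows "continuous_map Z E (\<lambda>z. f z - g z)"
proof -
  have "continuous_map Z (prod_topology euclideanreal E) (\<lambda>z. (-1, g z))"
    using assms(3) by (simp add: continuous_map_paired)
  then have "continuous_map Z E ((\<lambda>(c, x). c *\<^sub>R x) \<circ> (\<lambda>z. (-1, g z)))"
    using E unfolding lcs_def by (blast intro: continuous_map_compose)
  then have "continuous_map Z E (\<lambda>z. - g z)" by (simp add: o_def)
  then have "continuous_map Z (prod_topology E E) (\<lambda>z. (f z, - g z))"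
    using assms(2) by (simp add: continuous_map_paired)
  then have "continuous_map Z E ((\<lambda>(x, y). x + y) \<circ> (\<lambda>z. (f z, - g z)))"
    using E unfolding lcs_def by (blast intro: continuous_map_compose)
  then show ?thesis by (simp add: o_def)
qed

theorem free_lcs_universal:
  fixes X :: "'a topology" and L :: "'l::real_vector topology" and E :: "'e::real_vector topology"
  assumes free: "free_lcs X L i" and E: "lcs E" and f: "continuous_map X E f"
  shows "\<exists>!g. g \<in> extensional (topspace L) \<and> continuous_linear L E g \<and>
              (\<forall>x\<in>topspace X. f x = g (i x))"
proof -
  have L: "lcs L" and i: "continuous_map X L i" using free by (auto simp: free_lcs_def)
  have iL: "i x \<in> topspace L" if "x \<in> topspace X" for x
    using i that by (auto simp: continuous_map_def)
  have univ: "\<exists>!g. g \<in> extensional (topspace L) \<and> continuous_linear L F g \<and>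
                 (\<forall>x\<in>topspace X. u x = g (i x))"
    if "lcs F" "continuous_map X F u" for F :: "('a + 'l \<Rightarrow> real) topology" and u
    using free that unfolding free_lcs_def by blast
  show ?thesis
  proof (rule ex_ex1I)
    let ?k = "\<lambda>s. case s of Inl x \<Rightarrow> f x | Inr (_ :: 'l) \<Rightarrow> 0"
    let ?S = "span (?k ` Inl ` topspace X)"
    have "?k ` Inl ` topspace X \<subseteq> topspace E" using f by (auto simp: continuous_map_def)
    then obtain F :: "('a + 'l \<Rightarrow> real) topology" and p q where
      F: "lcs F" "continuous_linear F E q" "p ` ?S = topspace F"
        "continuous_linear (subtopology E ?S) F p" "\<And>v. v \<in> ?S \<Longrightarrow> q (p v) = v"
      using lcs_transport[OF E] by metis
    have fS: "f x \<in> ?S" if "x \<in> topspace X" for x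
      using that by (auto intro!: span_base simp: image_image)
    have "continuous_map X (subtopology E ?S) f"
      using f fS by (auto simp: continuous_map_in_subtopology)
    then have "continuous_map X F (p \<circ> f)"
      using F(4) unfolding continuous_linear_def by (blast intro: continuous_map_compose)
    then obtain g where g: "continuous_linear L F g" "\<forall>x\<in>topspace X. (p \<circ> f) x = g (i x)"
      using univ[OF F(1)] by blast
    show "\<exists>g. g \<in> extensional (topspace L) \<and> continuous_linear L E g \<and>
              (\<forall>x\<in>topspace X. f x = g (i x))"
    proof (intro exI conjI ballI)
      show "continuous_linear L E (restrict (q \<circ> g) (topspace L))"
        by (rule continuous_linear_restrict[OF L continuous_linear_compose[OF g(1) F(2)]])
      fix x assume x: "x \<in> topspace X"
      then have "q (g (i x)) = q (p (f x))" using g(2) by auto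
      then show "f x = restrict (q \<circ> g) (topspace L) (i x)"
        using F(5)[OF fS[OF x]] iL[OF x] by simp
    qed auto
  next
    fix g h
    assume g: "g \<in> extensional (topspace L) \<and> continuous_linear L E g \<and>
                (\<forall>x\<in>topspace X. f x = g (i x))"
      and h: "h \<in> extensional (topspace L) \<and> continuous_linear L E h \<and>
                (\<forall>x\<in>topspace X. f x = h (i x))"
    define d where "d y = g y - h y" for y
    have dE: "continuous_map L E d"
      unfolding d_def using g h by (intro lcs_continuous_map_diff[OF E]) (auto simp: continuous_linear_def)
    have dlin: "linear_on_set (topspace L) d"
      using g h by (auto simp: d_def continuous_linear_def linear_on_set_def scaleR_diff_right)
    let ?k = "\<lambda>s. case s of Inl (_ :: 'a) \<Rightarrow> 0 | Inr y \<Rightarrow> d y"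
    let ?S = "span (?k ` Inr ` topspace L)"
    have "?k ` Inr ` topspace L \<subseteq> topspace E" using dE by (auto simp: continuous_map_def)
    then obtain F :: "('a + 'l \<Rightarrow> real) topology" and p q where
      F: "lcs F" "continuous_linear F E q" "p ` ?S = topspace F"
        "continuous_linear (subtopology E ?S) F p" "\<And>v. v \<in> ?S \<Longrightarrow> q (p v) = v"
      using lcs_transport[OF E] by metis
    have dS: "d y \<in> ?S" if "y \<in> topspace L" for y
      using that by (auto intro!: span_base simp: image_image)
    have cd: "continuous_linear L (subtopology E ?S) d"
      using dE dS dlin by (auto simp: continuous_linear_def continuous_map_in_subtopology)
    have "p (0 *\<^sub>R 0) = 0 *\<^sub>R p 0"
      using F(4) E unfolding continuous_linear_def linear_on_set_def lcs_def
      by (metis IntI span_zero subspace_0 topspace_subtopology)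
    then have p0: "p 0 = 0" by simp
    have F0: "0 \<in> topspace F" using F(1) by (simp add: lcs_def subspace_0)
    have d0: "d (i x) = 0" if "x \<in> topspace X" for x
      using g h that by (simp add: d_def)
    have 1: "restrict (p \<circ> d) (topspace L) \<in> extensional (topspace L) \<and>
      continuous_linear L F (restrict (p \<circ> d) (topspace L)) \<and>
      (\<forall>x\<in>topspace X. 0 = restrict (p \<circ> d) (topspace L) (i x))"
      using continuous_linear_restrict[OF L continuous_linear_compose[OF cd F(4)]] d0 p0 iL by simp
    have "continuous_linear L F (\<lambda>_. 0)"
      using F0 by (simp add: continuous_linear_def linear_on_set_def)
    then have 2: "restrict (\<lambda>_. 0) (topspace L) \<in> extensional (topspace L) \<and>
      continuous_linear L F (restrict (\<lambda>_. 0) (topspace L)) \<and>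
      (\<forall>x\<in>topspace X. 0 = restrict (\<lambda>_. 0 :: 'a + 'l \<Rightarrow> real) (topspace L) (i x))"
      using continuous_linear_restrict[OF L] iL by simp
    have "continuous_map X F (\<lambda>_. 0)" using F0 by simp
    then have eq: "restrict (p \<circ> d) (topspace L) = restrict (\<lambda>_. 0) (topspace L)"
      using univ[OF F(1)] 1 2 by (metis (mono_tags, lifting))
    have "d y = 0" if y: "y \<in> topspace L" for y
    proof -
      have "p (d y) = 0" using fun_cong[OF eq, of y] y by simp
      then have "q (p (d y)) = q (p 0)" by (simp add: p0)
      then show ?thesis using F(5)[OF dS[OF y]] F(5)[OF span_zero] by simp
    qed
    then show "g = h"
      using g h by (intro extensionalityI[of g "topspace L" h]) (auto simp: d_def)
  qed
qed

end

theory Submission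
  imports Defs
begin

text \<open>
  By the universal property, \<open>L\<close> is spanned by \<open>i(X)\<close> (\<open>free_lcs_span\<close>), and every continuous
  real function on \<open>X\<close> is the restriction of an element of the dual (\<open>free_lcs_extend\<close>). So the dual
  of \<open>L\<close> is \<open>C(X)\<close>, and a sequence of functionals converges weak-* exactly when the corresponding
  functions converge pointwise on \<open>X\<close> to a continuous function.

  Suppose that all compact subsets of \<open>X\<close> are finite. The strong topology is then no finer than the
  topology of pointwise convergence, because a bounded set of \<open>L\<close> consists of combinations of
  finitely many fixed points of \<open>i(X)\<close> with uniformly bounded coefficients
  (\<open>free_lcs_bounded_finite_dimensional\<close>). Indeed, a gliding hump argument
  (\<open>functionally_bounded_support\<close>) shows that the supports of the elements of a bounded set have a
  functionally bounded union; in a \<open>\<mu>\<close>-space this union lies in a compact set, which is finite.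
  Hence weak-* convergent sequences even converge strongly, and therefore weakly.

  Conversely, let \<open>K\<close> be an infinite compact set. Around an accumulation point of \<open>K\<close> there are
  points \<open>x n \<in> K\<close> and continuous functions \<open>f n\<close> with \<open>f n (x n) = 1\<close> whose supports (here the sets
  where they do not vanish) are pairwise disjoint (\<open>disjoint_bumps_on_infinite_compact\<close>). By disjointness the functions
  \<open>2 ^ n * f n\<close> tend to \<open>0\<close> pointwise, however large they are. The measure
  \<open>\<Sum>k. (1/2) ^ k * \<delta>(x k)\<close> is supported by the compact closure of the points \<open>x k\<close>, so it is a
  continuous functional on the strong dual; it takes the value \<open>1\<close> at all these functions but has
  to vanish at a weak limit. So the sequence is weak-* convergent but not weakly convergent.
\<close>

section \<open>Weak limits and linear functionals\<close>

text \<open>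
  The open sets of the weak and weak-* topologies are generated by preimages under functionals;
  this turns their limits into limits of real sequences.
\<close>
lemma limitin_initial_topology:
  assumes "\<Phi> \<noteq> {}"
  shows "limitin (initial_topology S \<Phi>) f l F \<longleftrightarrow>
    l \<in> S \<and> eventually (\<lambda>n. f n \<in> S) F \<and> (\<forall>\<theta>\<in>\<Phi>. ((\<lambda>n. \<theta> (f n)) \<longlongrightarrow> \<theta> l) F)"
    (is "?L \<longleftrightarrow> ?R")
proof
  assume L: ?L
  have top: "topspace (initial_topology S \<Phi>) = S"
    by (rule topspace_initial_topology[OF assms])
  have l: "l \<in> S" using L top by (auto simp: limitin_def)
  have op: "openin (initial_topology S \<Phi>) {x \<in> S. \<theta> x \<in> U}" if "\<theta> \<in> \<Phi>" "open U" for \<theta> U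
    unfolding initial_topology_def using that by (intro topology_generated_by_Basis) blast
  have "eventually (\<lambda>n. f n \<in> S) F"
    using L top l openin_topspace[of "initial_topology S \<Phi>"] unfolding limitin_def by simp
  moreover have "((\<lambda>n. \<theta> (f n)) \<longlongrightarrow> \<theta> l) F" if \<theta>: "\<theta> \<in> \<Phi>" for \<theta>
  proof (rule topological_tendstoI)
    fix U :: "real set" assume "open U" "\<theta> l \<in> U"
    then have "eventually (\<lambda>n. f n \<in> {x \<in> S. \<theta> x \<in> U}) F"
      using L op[OF \<theta>] l unfolding limitin_def by blast
    then show "eventually (\<lambda>n. \<theta> (f n) \<in> U) F" by (rule eventually_mono) auto
  qed
  ultimately show ?R using l by blast
next
  assume R: ?R
  have "eventually (\<lambda>n. f n \<in> U) F" if "openin (initial_topology S \<Phi>) U" "l \<in> U" for U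
  proof -
    have "generate_topology_on {{x \<in> S. \<phi> x \<in> U} | \<phi> U. \<phi> \<in> \<Phi> \<and> open U} U"
      using that(1) unfolding initial_topology_def by (rule openin_topology_generated_by)
    then show ?thesis using that(2)
    proof induction
      case Empty then show ?case by simp
    next
      case (Int a b) then show ?case by (auto intro: eventually_conj)
    next
      case (UN K)
      then obtain k where "k \<in> K" "l \<in> k" by blast
      with UN.IH have "eventually (\<lambda>n. f n \<in> k) F" by blast
      then show ?case by (rule eventually_mono) (use \<open>k \<in> K\<close> in blast)
    next
      case (Basis s)
      then obtain \<phi> V where s: "s = {x \<in> S. \<phi> x \<in> V}" "\<phi> \<in> \<Phi>" "open V" by blast
      then have "eventually (\<lambda>n. \<phi> (f n) \<in> V) F"
        using R Basis.prems by (auto dest: topological_tendstoD)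
      then show ?case using R s(1) by (auto elim: eventually_elim2)
    qed
  qed
  then show ?L using R topspace_initial_topology[OF assms] by (auto simp: limitin_def)
qed

lemma linear_on_set_sum:
  assumes S: "subspace S" and f: "linear_on_set S f" and g: "\<And>x. x \<in> A \<Longrightarrow> g x \<in> S"
  shows "f (\<Sum>x\<in>A. c x *\<^sub>R g x) = (\<Sum>x\<in>A. c x *\<^sub>R f (g x))"
proof -
  have f0: "f 0 = 0"
  proof -
    have "f (0 *\<^sub>R 0) = 0 *\<^sub>R f 0" using f S unfolding linear_on_set_def by (blast dest: subspace_0)
    then show ?thesis by simp
  qed
  show ?thesis using g
  proof (induction A rule: infinite_finite_induct)
    case (insert a A)
    have "(\<Sum>x\<in>A. c x *\<^sub>R g x) \<in> S" "c a *\<^sub>R g a \<in> S" "g a \<in> S"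
      using insert.prems S by (auto intro!: subspace_sum subspace_scale)
    then show ?case using insert f by (simp add: linear_on_set_def)
  qed (auto simp: f0)
qed

lemma lcs_euclideanreal: "lcs euclideanreal"
  unfolding lcs_def
proof (intro conjI allI impI)
  show "continuous_map (prod_topology euclideanreal euclideanreal) euclideanreal (\<lambda>(x, y). x + y)"
    by (auto simp: euclidean_product_topology case_prod_beta intro!: continuous_intros)
  show "continuous_map (prod_topology euclideanreal euclideanreal) euclideanreal
      (\<lambda>(c, x). c *\<^sub>R x)"
    by (auto simp: euclidean_product_topology case_prod_beta intro!: continuous_intros)
  fix U :: "real set" assume "openin euclideanreal U \<and> 0 \<in> U"
  then obtain e where "e > 0" "ball 0 e \<subseteq> U" by (auto simp: open_contains_ball)
  then show "\<exists>V. openin euclideanreal V \<and> convex V \<and> 0 \<in> V \<and> V \<subseteq> U"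
    by (intro exI[of _ "ball 0 e"]) auto
qed (auto simp: Hausdorff_space_euclidean)

lemma subspace_dual_space:
  assumes "lcs E"
  shows "subspace (dual_space E)"
proof -
  have S: "subspace (topspace E)" using assms by (simp add: lcs_def)
  show ?thesis
    unfolding subspace_def[of "dual_space E"]
  proof (intro conjI ballI allI)
    fix \<phi> \<psi> assume "\<phi> \<in> dual_space E" "\<psi> \<in> dual_space E"
    then show "\<phi> + \<psi> \<in> dual_space E"
      by (simp add: dual_space_def continuous_linear_def linear_on_set_def distrib_left
          continuous_map_add plus_fun_def)
  next
    fix c \<phi> assume "\<phi> \<in> dual_space E"
    then show "c *\<^sub>R \<phi> \<in> dual_space E"
      by (simp add: dual_space_def continuous_linear_def linear_on_set_def distrib_left
          scaleR_fun_def continuous_map_real_mult_left)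
  qed (rule zero_in_dual_space)
qed

section \<open>Bounded sets and the strong dual\<close>

lemma dual_space_bounded_image:
  assumes B: "lcs_bounded E B" and \<phi>: "\<phi> \<in> dual_space E" and E: "lcs E"
  shows "bounded (\<phi> ` B)"
proof -
  have S: "subspace (topspace E)" using E by (simp add: lcs_def)
  have lin: "linear_on_set (topspace E) \<phi>" and c: "continuous_map E euclideanreal \<phi>"
    using \<phi> by (auto simp: dual_space_def continuous_linear_def)
  let ?U = "{x \<in> topspace E. \<phi> x \<in> {-1<..<1}}"
  have "\<phi> 0 = 0"
    using lin subspace_0[OF S] linear_on_set_sum[OF S lin, of "{}"] by simp
  then have U0: "0 \<in> ?U" using subspace_0[OF S] by simp
  have Uopen: "openin E ?U" by (rule openin_continuous_map_preimage[OF c]) simp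
  have "\<forall>U. openin E U \<and> 0 \<in> U \<longrightarrow> (\<exists>r>0. \<forall>s\<ge>r. B \<subseteq> (\<lambda>x. s *\<^sub>R x) ` U)"
    using B unfolding lcs_bounded_def by (rule conjunct2)
  from this[rule_format, of ?U] Uopen U0
  obtain r where r: "r > 0" "\<forall>s\<ge>r. B \<subseteq> (\<lambda>x. s *\<^sub>R x) ` ?U" by blast
  have "\<bar>\<phi> y\<bar> \<le> r" if "y \<in> B" for y
  proof -
    have "B \<subseteq> (\<lambda>x. r *\<^sub>R x) ` ?U" using r(2) by simp
    then have "y \<in> (\<lambda>x. r *\<^sub>R x) ` ?U" using that by (rule subsetD)
    then obtain x where x: "x \<in> ?U" "y = r *\<^sub>R x" by blast
    then have "\<phi> y = r * \<phi> x" using lin by (simp add: linear_on_set_def)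
    moreover have "\<bar>\<phi> x\<bar> \<le> 1" using x(1) by auto
    ultimately show ?thesis using r(1) by (simp add: abs_mult)
  qed
  then show ?thesis by (auto simp: bounded_iff)
qed

text \<open>
  A convex neighbourhood \<open>V\<close> of \<open>0\<close> has increasing multiples \<open>n V\<close> that exhaust the space, so a
  compact set lies in one of them. Convexity also gives the inclusion in \<open>s V\<close> for all larger \<open>s\<close>,
  as the definition of boundedness demands.
\<close>
lemma compactin_imp_lcs_bounded:
  assumes E: "lcs E" and B: "compactin E B"
  shows "lcs_bounded E B"
  unfolding lcs_bounded_def
proof (intro conjI allI impI)
  show BE: "B \<subseteq> topspace E" by (rule compactin_subset_topspace[OF B])
  have smult: "continuous_map (prod_topology euclideanreal E) E (\<lambda>(c, x). c *\<^sub>R x)"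
    using E by (simp add: lcs_def)
  fix U assume "openin E U \<and> 0 \<in> U"
  then obtain V where V: "openin E V" "convex V" "0 \<in> V" "V \<subseteq> U"
    using E unfolding lcs_def by blast
  have shrink: "t *\<^sub>R y \<in> V" if "y \<in> V" "0 \<le> t" "t \<le> 1" for t y
    using convexD[OF V(2) that(1) V(3), of t "1 - t"] that by simp
  define W where "W n = {y \<in> topspace E. inverse (real (Suc n)) *\<^sub>R y \<in> V}" for n
  have Wopen: "openin E (W n)" for n
  proof -
    have "continuous_map E E ((\<lambda>(c, x). c *\<^sub>R x) \<circ> (\<lambda>y. (inverse (real (Suc n)), y)))"
      by (rule continuous_map_compose[OF _ smult]) (simp add: continuous_map_pairedI)
    then show ?thesis
      unfolding W_def using openin_continuous_map_preimage[OF _ V(1)] by (simp add: o_def)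
  qed
  have cover: "\<exists>n. y \<in> W n" if y: "y \<in> topspace E" for y
  proof -
    have "continuous_map euclideanreal E ((\<lambda>(c, x). c *\<^sub>R x) \<circ> (\<lambda>c. (c, y)))"
      by (rule continuous_map_compose[OF _ smult]) (simp add: y continuous_map_pairedI)
    then have "openin euclideanreal {c \<in> topspace euclideanreal. c *\<^sub>R y \<in> V}"
      using openin_continuous_map_preimage[OF _ V(1)] by (fastforce simp: o_def)
    then have "open {c. c *\<^sub>R y \<in> V}" by simp
    moreover have "0 \<in> {c. c *\<^sub>R y \<in> V}" using V(3) by simp
    ultimately have "eventually (\<lambda>n. inverse (real (Suc n)) \<in> {c. c *\<^sub>R y \<in> V}) sequentially"
      using LIMSEQ_inverse_real_of_nat by (auto dest: topological_tendstoD)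
    then show ?thesis using y by (auto simp: W_def eventually_sequentially)
  qed
  obtain \<F> where F: "finite \<F>" "\<F> \<subseteq> range W" "B \<subseteq> \<Union>\<F>"
  proof -
    have "\<And>U. U \<in> range W \<Longrightarrow> openin E U" "B \<subseteq> \<Union>(range W)" using Wopen cover BE by auto
    then show ?thesis using B that unfolding compactin_def by meson
  qed
  then obtain N where N: "finite N" "\<F> = W ` N" by (meson finite_subset_image)
  define r where "r = real (Suc (Max (insert 0 N)))"
  have "B \<subseteq> (\<lambda>x. s *\<^sub>R x) ` U" if s: "s \<ge> r" for s
  proof
    fix y assume "y \<in> B"
    then obtain n where n: "n \<in> N" "y \<in> W n" using F N by blast
    then have "n \<le> Max (insert 0 N)" using N(1) by simp
    then have sn: "real (Suc n) \<le> s" "s > 0" using s by (auto simp: r_def)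
    have "inverse (real (Suc n)) *\<^sub>R y \<in> V" using n(2) unfolding W_def by blast
    then have "(real (Suc n) / s) *\<^sub>R (inverse (real (Suc n)) *\<^sub>R y) \<in> V"
      by (rule shrink) (use sn in \<open>simp_all add: divide_le_eq\<close>)
    moreover have "real (Suc n) / s * inverse (real (Suc n)) = inverse s"
      by (simp add: field_simps)
    ultimately have "inverse s *\<^sub>R y \<in> U" using V(4) by (metis scaleR_scaleR subsetD)
    then show "y \<in> (\<lambda>x. s *\<^sub>R x) ` U" using sn(2) by (intro image_eqI) auto
  qed
  then show "\<exists>r>0. \<forall>s\<ge>r. B \<subseteq> (\<lambda>x. s *\<^sub>R x) ` U"
    by (intro exI[of _ r]) (auto simp: r_def)
qed

text \<open>
  The hypothesis says that \<open>\<theta>\<close> is Lipschitz for the uniform distance on a single bounded set. The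
  elements of the bidual used below, evaluations and absolutely convergent sums of evaluations, are
  of this kind.
\<close>
lemma dual_space_strong_dualI:
  assumes lin: "linear_on_set (dual_space E) \<theta>"
    and out: "\<And>\<psi>. \<psi> \<notin> dual_space E \<Longrightarrow> \<theta> \<psi> = 0"
    and B: "lcs_bounded E B"
    and le: "\<And>\<psi> \<psi>' \<delta>. \<lbrakk>\<psi> \<in> dual_space E; \<psi>' \<in> dual_space E; \<delta> > 0; \<And>x. x \<in> B \<Longrightarrow> \<bar>\<psi>' x - \<psi> x\<bar> < \<delta>\<rbrakk>
       \<Longrightarrow> \<bar>\<theta> \<psi>' - \<theta> \<psi>\<bar> \<le> C * \<delta>"
    and C: "C > 0"
  shows "\<theta> \<in> dual_space (strong_dual E)"
proof -
  have "openin (strong_dual E) {\<psi> \<in> dual_space E. \<theta> \<psi> \<in> U}" if U: "open U" for U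
    unfolding openin_strong_dual strong_open_def
  proof (intro conjI ballI)
    fix \<psi> assume \<psi>: "\<psi> \<in> {\<psi> \<in> dual_space E. \<theta> \<psi> \<in> U}"
    then obtain e where e: "e > 0" "\<And>t. \<bar>t - \<theta> \<psi>\<bar> < e \<Longrightarrow> t \<in> U"
      using U by (auto simp: open_real)
    have "\<theta> \<psi>' \<in> U" if "\<psi>' \<in> dual_space E" "\<forall>x\<in>B. \<bar>\<psi>' x - \<psi> x\<bar> < e / (2 * C)" for \<psi>'
    proof -
      have "\<bar>\<theta> \<psi>' - \<theta> \<psi>\<bar> \<le> C * (e / (2 * C))" using \<psi> that e(1) C by (intro le) auto
      also have "\<dots> < e" using C e(1) by simp
      finally show ?thesis by (rule e(2))
    qed
    then show "\<exists>B \<epsilon>. lcs_bounded E B \<and> 0 < \<epsilon> \<and> {\<psi>' \<in> dual_space E. \<forall>x\<in>B. \<bar>\<psi>' x - \<psi> x\<bar> < \<epsilon>}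
        \<subseteq> {\<psi> \<in> dual_space E. \<theta> \<psi> \<in> U}"
      using B C e(1) by (intro exI[of _ B] exI[of _ "e / (2 * C)"]) auto
  qed auto
  then show ?thesis
    using lin out
    by (auto simp: dual_space_def[of "strong_dual E"] continuous_linear_def topspace_strong_dual
        continuous_map_def)
qed

lemma strong_dual_limitI:
  assumes "l \<in> dual_space E" "\<And>n. \<phi> n \<in> dual_space E"
    and "\<And>B. lcs_bounded E B \<Longrightarrow> uniform_limit B \<phi> l F"
  shows "limitin (strong_dual E) \<phi> l F"
  unfolding limitin_def topspace_strong_dual openin_strong_dual
proof (intro conjI allI impI)
  show "l \<in> dual_space E" by fact
  fix U assume "strong_open E U \<and> l \<in> U"
  then obtain B \<epsilon> where B: "lcs_bounded E B" "0 < \<epsilon>"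
    "{\<psi> \<in> dual_space E. \<forall>x\<in>B. \<bar>\<psi> x - l x\<bar> < \<epsilon>} \<subseteq> U"
    unfolding strong_open_def by blast
  have "eventually (\<lambda>n. \<forall>x\<in>B. \<bar>\<phi> n x - l x\<bar> < \<epsilon>) F"
    using assms(3)[OF B(1)] B(2) by (auto simp: uniform_limit_iff dist_real_def)
  then show "eventually (\<lambda>n. \<phi> n \<in> U) F"
    by (rule eventually_mono) (use B(3) assms(2) in blast)
qed

lemma limitin_imp_limitin_weak_topology:
  assumes "limitin E f l F"
  shows "limitin (weak_topology E) f l F"
proof -
  have "dual_space E \<noteq> {}" using zero_in_dual_space by blast
  moreover have "((\<lambda>n. \<theta> (f n)) \<longlongrightarrow> \<theta> l) F" if "\<theta> \<in> dual_space E" for \<theta>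
  proof -
    have "continuous_map E euclideanreal \<theta>"
      using that by (auto simp: dual_space_def continuous_linear_def)
    then have "limitin euclideanreal (\<theta> \<circ> f) (\<theta> l) F" using assms by (rule continuous_map_limit)
    then show ?thesis by (simp add: o_def)
  qed
  moreover have "l \<in> topspace E" "eventually (\<lambda>n. f n \<in> topspace E) F"
    using assms openin_topspace[of E] by (auto simp: limitin_def)
  ultimately show ?thesis
    unfolding weak_topology_def by (simp add: limitin_initial_topology)
qed

section \<open>Finitely supported functions on a Tychonoff space\<close>

text \<open>
  A finitely supported \<open>a\<close> stands for the measure that has mass \<open>a x\<close> at \<open>x\<close>, and later for the
  element of the free locally convex space with these coefficients.
\<close>
definition pairing :: "('a \<Rightarrow> real) \<Rightarrow> ('a \<Rightarrow> real) \<Rightarrow> real" where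
  "pairing a f = (\<Sum>x | a x \<noteq> 0. a x * f x)"

lemma pairing_cong:
  "(\<And>x. a x \<noteq> 0 \<Longrightarrow> f x = g x) \<Longrightarrow> pairing a f = pairing a g"
  unfolding pairing_def by (rule sum.cong) auto

lemma pairing_add_mult: "pairing a (\<lambda>x. f x + c * g x) = pairing a f + c * pairing a g"
  by (simp add: pairing_def distrib_left sum.distrib sum_distrib_left mult.left_commute)

lemma pairing_single:
  assumes "finite {x. a x \<noteq> 0}" "\<And>z. a z \<noteq> 0 \<Longrightarrow> z \<noteq> x \<Longrightarrow> f z = 0"
  shows "pairing a f = a x * f x"
proof -
  have "pairing a f = (\<Sum>z | a z \<noteq> 0. if z = x then a x * f x else 0)"
    unfolding pairing_def by (rule sum.cong) (auto simp: assms(2))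
  then show ?thesis using assms(1) by (simp add: sum.delta)
qed

lemma Tychonoff_bump:
  assumes "Tychonoff_space X" "openin X U" "x \<in> U"
  obtains h :: "'a \<Rightarrow> real" where
    "continuous_map X euclideanreal h" "h x = 1" "\<And>z. z \<in> topspace X \<Longrightarrow> z \<notin> U \<Longrightarrow> h z = 0"
proof -
  have "completely_regular_space X" using assms(1) by (simp add: Tychonoff_space_def)
  then obtain h :: "'a \<Rightarrow> real" where
    "continuous_map X euclideanreal h" "h x = 1" "h ` (topspace X - U) \<subseteq> {0}"
    using assms(2,3) unfolding completely_regular_space_gen_alt'[of "1::real" 0 X, simplified]
    by meson
  then show ?thesis by (intro that[of h]) auto
qed

text \<open>
  Gliding hump: if some continuous \<open>f\<close> is unbounded on the union of the supports, put \<open>g = \<bar>f\<bar>\<close> and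
  build a continuous \<open>G\<close> on the growing open sets \<open>{g < M n}\<close>. Some member of \<open>A\<close> has a point of its
  support beyond the current level, and adding a bump at that point gives the pairing with this
  member any prescribed value without changing the function below the level. Raising the level
  above the support of that member protects the value from all later steps. Since every point
  is eventually below the level, the functions fit together to a \<open>G\<close> whose pairings with \<open>A\<close> are
  unbounded.
\<close>
lemma functionally_bounded_support:
  fixes X :: "'a topology" and A :: "('a \<Rightarrow> real) set"
  assumes X: "Tychonoff_space X"
    and fin: "\<And>a. a \<in> A \<Longrightarrow> finite {x. a x \<noteq> 0}"
    and sub: "\<And>a. a \<in> A \<Longrightarrow> {x. a x \<noteq> 0} \<subseteq> topspace X"
    and bnd: "\<And>f. continuous_map X euclideanreal f \<Longrightarrow> bounded ((\<lambda>a. pairing a f) ` A)"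
  shows "functionally_bounded_in X (\<Union>a\<in>A. {x. a x \<noteq> 0})"
proof (rule ccontr)
  assume "\<not> ?thesis"
  then obtain f where f: "continuous_map X euclideanreal f"
    and unb: "\<not> bounded (f ` (\<Union>a\<in>A. {x. a x \<noteq> 0}))"
    using sub unfolding functionally_bounded_in_def by blast
  define g where "g x = \<bar>f x\<bar>" for x
  have g: "continuous_map X euclideanreal g"
    unfolding g_def using f by (rule continuous_map_real_abs)
  have g0: "g x \<ge> 0" for x by (simp add: g_def)
  have far: "\<exists>a\<in>A. \<exists>x. a x \<noteq> 0 \<and> g x > M" for M
  proof (rule ccontr)
    assume "\<not> ?thesis"
    then have "bounded (f ` (\<Union>a\<in>A. {x. a x \<noteq> 0}))"
      by (intro boundedI[of _ M]) (auto simp: g_def not_less)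
    with unb show False ..
  qed
  have step: "\<exists>F' M'. continuous_map X euclideanreal F' \<and> M' \<ge> M + 1 \<and>
      (\<forall>x\<in>topspace X. g x < M \<longrightarrow> F' x = F x) \<and>
      (\<exists>a\<in>A. pairing a F' = t \<and> (\<forall>x. a x \<noteq> 0 \<longrightarrow> g x < M'))"
    if F: "continuous_map X euclideanreal F" and M: "M \<ge> 0" for F and M t :: real
  proof -
    obtain a x where a: "a \<in> A" "a x \<noteq> 0" "g x > M" using far by blast
    \<comment> \<open>The bump avoids the other support points, so that its pairing with \<open>a\<close> is \<open>a x\<close>.\<close>
    let ?S = "{z. a z \<noteq> 0} - {x}"
    let ?U = "{z \<in> topspace X. g z \<in> {M<..}} - ?S"
    have "closedin X ?S"
      using X fin[OF a(1)] sub[OF a(1)] by (intro closedin_Hausdorff_finite) (auto simp: Tychonoff_space_def)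
    moreover have "openin X {z \<in> topspace X. g z \<in> {M<..}}"
      by (rule openin_continuous_map_preimage[OF g]) simp
    ultimately have "openin X ?U" by (intro openin_diff)
    moreover have "x \<in> ?U" using a sub[OF a(1)] by auto
    ultimately obtain h where h: "continuous_map X euclideanreal h" "h x = 1"
      "\<And>z. z \<in> topspace X \<Longrightarrow> z \<notin> ?U \<Longrightarrow> h z = 0"
      by (rule Tychonoff_bump[OF X]) blast
    have "pairing a h = a x"
      using pairing_single[OF fin[OF a(1)], of x h] h(2,3) sub[OF a(1)] by auto
    define c where "c = (t - pairing a F) / a x"
    define M' where "M' = M + 1 + (\<Sum>z | a z \<noteq> 0. g z)"
    show ?thesis
    proof (intro exI conjI bexI[of _ a] allI impI ballI)
      show "continuous_map X euclideanreal (\<lambda>z. F z + c * h z)"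
        by (intro continuous_map_add continuous_map_real_mult_left F h(1))
      show "M + 1 \<le> M'" unfolding M'_def by (simp add: g0 sum_nonneg)
      show "pairing a (\<lambda>z. F z + c * h z) = t"
        unfolding pairing_add_mult \<open>pairing a h = a x\<close> c_def using a(2) by simp
      show "g z < M'" if "a z \<noteq> 0" for z
      proof -
        have "g z \<le> (\<Sum>z | a z \<noteq> 0. g z)" using that fin[OF a(1)] g0 by (intro member_le_sum) auto
        then show ?thesis using M by (simp add: M'_def)
      qed
      show "F z + c * h z = F z" if "z \<in> topspace X" "g z < M" for z
        using h(3)[of z] that by simp
    qed (rule a(1))
  qed
  \<comment> \<open>A state is a pair of the current function and the current level.\<close>
  define P where "P n s \<longleftrightarrow> continuous_map X euclideanreal (fst s) \<and> real n \<le> snd s"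
    for n :: nat and s :: "('a \<Rightarrow> real) \<times> real"
  define Q where "Q n s s' \<longleftrightarrow> snd s + 1 \<le> snd s' \<and>
      (\<forall>x\<in>topspace X. g x < snd s \<longrightarrow> fst s' x = fst s x) \<and>
      (\<exists>a\<in>A. pairing a (fst s') = real n \<and> (\<forall>x. a x \<noteq> 0 \<longrightarrow> g x < snd s'))"
    for n :: nat and s s' :: "('a \<Rightarrow> real) \<times> real"
  have "\<exists>s. \<forall>n. P n (s n) \<and> Q n (s n) (s (Suc n))"
  proof (rule dependent_nat_choice)
    show "\<exists>s. P 0 s" by (rule exI[of _ "(\<lambda>_. 0, 0)"]) (simp add: P_def)
    fix s n assume s: "P n s"
    then obtain F' M' where "continuous_map X euclideanreal F'" "M' \<ge> snd s + 1"
      "\<forall>x\<in>topspace X. g x < snd s \<longrightarrow> F' x = fst s x"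
      "\<exists>a\<in>A. pairing a F' = real n \<and> (\<forall>x. a x \<noteq> 0 \<longrightarrow> g x < M')"
      using step[of "fst s" "snd s" "real n"] by (auto simp: P_def)
    with s show "\<exists>s'. P (Suc n) s' \<and> Q n s s'"
      by (intro exI[of _ "(F', M')"]) (auto simp: P_def Q_def)
  qed
  then obtain s where P: "P n (s n)" and Q: "Q n (s n) (s (Suc n))" for n by blast
  define F where "F n = fst (s n)" for n
  define M where "M n = snd (s n)" for n
  have F: "continuous_map X euclideanreal (F n)" and M: "real n \<le> M n" for n
    using P[of n] by (auto simp: P_def F_def M_def)
  have MSuc: "M n \<le> M (Suc n)" for n using Q[of n] by (simp add: Q_def M_def)
  have Mmono: "M m \<le> M n" if "m \<le> n" for m n
    using that MSuc by (rule lift_Suc_mono_le[rotated])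
  have agree: "F n x = F m x" if "m \<le> n" "x \<in> topspace X" "g x < M m" for m n x
    using that(1)
  proof (induction rule: dec_induct)
    case (step n)
    have "g x < M n" using that(3) Mmono[OF step(1)] by simp
    then show ?case using Q[of n] that(2) step.IH by (simp add: Q_def F_def M_def)
  qed simp
  let ?T = "\<lambda>n. {x \<in> topspace X. g x \<in> {..<M n}}"
  obtain G where G: "continuous_map X euclideanreal G"
    and GF: "\<And>x n. n \<in> UNIV \<Longrightarrow> x \<in> topspace X \<inter> ?T n \<Longrightarrow> G x = F n x"
  proof (rule pasting_lemma_exists[where X = X and I = UNIV and T = ?T and Y = euclideanreal and f = F])
    show "topspace X \<subseteq> \<Union>(range ?T)"
    proof
      fix x assume "x \<in> topspace X"
      moreover obtain n where "g x < real n" using reals_Archimedean2 by blast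
      then have "g x < M n" using M[of n] by simp
      ultimately show "x \<in> \<Union>(range ?T)" by blast
    qed
    show "openin X (?T n)" for n by (rule openin_continuous_map_preimage[OF g]) simp
    show "continuous_map (subtopology X (?T n)) euclideanreal (F n)" for n
      by (rule continuous_map_from_subtopology[OF F])
    show "F m x = F n x" if "x \<in> topspace X \<inter> ?T m \<inter> ?T n" for m n x
      using agree[of m n x] agree[of n m x] that by (cases m n rule: linorder_le_cases) auto
  qed blast
  obtain C where C: "\<And>a. a \<in> A \<Longrightarrow> \<bar>pairing a G\<bar> \<le> C"
    using bnd[OF G] by (auto simp: bounded_iff)
  obtain n where n: "C < real n" using reals_Archimedean2 by blast
  obtain a where a: "a \<in> A" "pairing a (F (Suc n)) = real n" "\<And>x. a x \<noteq> 0 \<Longrightarrow> g x < M (Suc n)"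
    using Q[of n] by (auto simp: Q_def F_def M_def)
  have "pairing a G = pairing a (F (Suc n))"
    using a(3) sub[OF a(1)] by (intro pairing_cong GF) auto
  then show False using C[OF a(1)] a(2) n by simp
qed

text \<open>
  Let \<open>p\<close> be an accumulation point of \<open>K\<close>. Inside a neighbourhood \<open>V\<close> of \<open>p\<close> there is a point
  \<open>x \<noteq> p\<close> of \<open>K\<close>, and a bump at \<open>x\<close> can be supported in \<open>V\<close> off a smaller neighbourhood \<open>V'\<close>
  of \<open>p\<close>. Iterating with \<open>V'\<close> in place of \<open>V\<close> puts the supports into disjoint shells.
\<close>
lemma disjoint_bumps_on_infinite_compact:
  fixes X :: "'a topology"
  assumes X: "Tychonoff_space X" and K: "compactin X K" "infinite K"
  shows "\<exists>(x :: nat \<Rightarrow> 'a) (f :: nat \<Rightarrow> 'a \<Rightarrow> real).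
    (\<forall>n. x n \<in> K \<and> continuous_map X euclideanreal (f n) \<and> f n (x n) = 1) \<and>
    (\<forall>z\<in>topspace X. \<forall>m n. m \<noteq> n \<longrightarrow> f m z = 0 \<or> f n z = 0)"
proof -
  have "K \<inter> X derived_set_of K \<noteq> {}"
    by (rule compactin_imp_Bolzano_Weierstrass[OF K(1)]) (use K in auto)
  then obtain p where p: "p \<in> topspace X" "\<And>T. p \<in> T \<Longrightarrow> openin X T \<Longrightarrow> \<exists>y\<noteq>p. y \<in> K \<and> y \<in> T"
    by (metis Int_emptyI in_derived_set_of)
  have KX: "K \<subseteq> topspace X" by (rule compactin_subset_topspace[OF K(1)])
  have step: "\<exists>x f V'. x \<in> K \<and> continuous_map X euclideanreal f \<and> f x = 1 \<and>
      openin X V' \<and> p \<in> V' \<and> V' \<subseteq> V \<and> (\<forall>z\<in>topspace X. f z \<noteq> (0::real) \<longrightarrow> z \<in> V - V')"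
    if V: "openin X V" "p \<in> V" for V
  proof -
    obtain x where x: "x \<noteq> p" "x \<in> K" "x \<in> V" using p(2) V by blast
    have "Hausdorff_space X" using X by (simp add: Tychonoff_space_def)
    then obtain P R where PR: "openin X P" "openin X R" "p \<in> P" "x \<in> R" "disjnt P R"
      using p(1) x KX unfolding Hausdorff_space_def by (metis subsetD)
    obtain f where f: "continuous_map X euclideanreal f" "f x = 1"
      "\<And>z. z \<in> topspace X \<Longrightarrow> z \<notin> V \<inter> R \<Longrightarrow> f z = 0"
      by (rule Tychonoff_bump[OF X, of "V \<inter> R" x]) (use V PR x in auto)
    have "\<forall>z\<in>topspace X. f z \<noteq> 0 \<longrightarrow> z \<in> V - V \<inter> P"
      using f(3) PR(5) unfolding disjnt_def by blast
    then show ?thesis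
      using f x V PR by (intro exI[of _ x] exI[of _ f] exI[of _ "V \<inter> P"]) auto
  qed
  then obtain x f N where N: "\<And>V. openin X V \<Longrightarrow> p \<in> V \<Longrightarrow>
      x V \<in> K \<and> continuous_map X euclideanreal (f V) \<and> f V (x V) = 1 \<and>
      openin X (N V) \<and> p \<in> N V \<and> N V \<subseteq> V \<and> (\<forall>z\<in>topspace X. f V z \<noteq> (0::real) \<longrightarrow> z \<in> V - N V)"
    by metis
  define V where "V n = (N ^^ n) (topspace X)" for n
  have VSuc: "V (Suc n) = N (V n)" for n by (simp add: V_def)
  have V: "openin X (V n) \<and> p \<in> V n" for n
  proof (induction n)
    case 0 show ?case using p(1) by (simp add: V_def)
  next
    case (Suc n) then show ?case using N[of "V n"] by (simp add: VSuc)
  qed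
  have "V (Suc n) \<subseteq> V n" for n using N[of "V n"] V[of n] by (simp add: VSuc)
  then have Vanti: "V n \<subseteq> V m" if "m \<le> n" for m n
    using that by (rule lift_Suc_antimono_le)
  have supp: "z \<in> V n - V (Suc n)" if "z \<in> topspace X" "f (V n) z \<noteq> 0" for n z
    using N[of "V n"] V[of n] that by (simp add: VSuc)
  have disj: "f (V m) z = 0 \<or> f (V n) z = 0" if z: "z \<in> topspace X" and "m \<noteq> n" for m n z
  proof (rule ccontr)
    assume "\<not> ?thesis"
    then have "z \<in> V m - V (Suc m)" "z \<in> V n - V (Suc n)" using supp z by auto
    moreover have "Suc m \<le> n \<or> Suc n \<le> m" using \<open>m \<noteq> n\<close> by linarith
    ultimately show False using Vanti[of "Suc m" n] Vanti[of "Suc n" m] by blast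
  qed
  show ?thesis
  proof (intro exI[of _ "\<lambda>n. x (V n)"] exI[of _ "\<lambda>n. f (V n)"] conjI allI ballI impI)
    fix n
    show "x (V n) \<in> K" "continuous_map X euclideanreal (f (V n))" "f (V n) (x (V n)) = 1"
      using N[of "V n"] V[of n] by simp_all
  qed (rule disj)
qed

section \<open>The free locally convex space\<close>

lemma free_lcs_extend:
  assumes "free_lcs X L i" "continuous_map X euclideanreal f"
  shows "\<exists>\<phi>\<in>dual_space L. \<forall>x\<in>topspace X. \<phi> (i x) = f x"
proof -
  have L: "lcs L" and i: "continuous_map X L i" using assms(1) by (auto simp: free_lcs_def)
  obtain g where g: "continuous_linear L euclideanreal g" "\<And>x. x \<in> topspace X \<Longrightarrow> f x = g (i x)"
    using free_lcs_universal[OF assms(1) lcs_euclideanreal assms(2)] by blast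
  have S: "subspace (topspace L)" using L by (simp add: lcs_def)
  define \<phi> where "\<phi> y = (if y \<in> topspace L then g y else 0)" for y
  have "continuous_map L euclideanreal \<phi>"
    by (rule continuous_map_eq[of _ _ g]) (use g(1) in \<open>auto simp: continuous_linear_def \<phi>_def\<close>)
  then have "\<phi> \<in> dual_space L"
    using g(1) S
    by (simp add: dual_space_def continuous_linear_def linear_on_set_def \<phi>_def subspace_add subspace_scale)
  moreover have "\<phi> (i x) = f x" if "x \<in> topspace X" for x
    using g(2)[OF that] continuous_map_image_subset_topspace[OF i] that by (auto simp: \<phi>_def)
  ultimately show ?thesis by blast
qed

text \<open>
  The span \<open>M\<close> of \<open>i(X)\<close> with the topology induced by \<open>L\<close> is itself a test space. The operator from
  \<open>L\<close> to \<open>M\<close> that extends \<open>i\<close> is, as an operator into \<open>L\<close>, the identity by uniqueness. Hence \<open>M\<close> is all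
  of \<open>L\<close>, and not just dense in it.
\<close>
lemma free_lcs_span:
  assumes free: "free_lcs X L i"
  shows "topspace L = span (i ` topspace X)"
proof
  have L: "lcs L" and i: "continuous_map X L i" using free by (auto simp: free_lcs_def)
  have S: "subspace (topspace L)" using L by (simp add: lcs_def)
  let ?S = "span (i ` topspace X)"
  show SL: "?S \<subseteq> topspace L"
    by (rule span_minimal[OF continuous_map_image_subset_topspace[OF i] S])
  define M where "M = pullback_topology ?S id L"
  have topM: "topspace M = ?S" using SL by (auto simp: M_def topspace_pullback_topology)
  have "lcs M"
    unfolding M_def using SL by (intro lcs_pullback[OF L]) (auto simp: linear_on_set_def)
  moreover have "continuous_map X M i"
    unfolding M_def by (rule continuous_map_pullback') (auto simp: i intro: span_base)
  ultimately obtain g where g: "continuous_linear L M g" "\<forall>x\<in>topspace X. i x = g (i x)"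
    using free_lcs_universal[OF free] by blast
  have incl: "continuous_map M L id"
    unfolding M_def using continuous_map_pullback[of L L id ?S id] by simp
  have gL: "continuous_linear L L g"
    using continuous_linear_compose[OF g(1), of L id] incl
    by (simp add: continuous_linear_def linear_on_set_def)
  have iL: "i x \<in> topspace L" if "x \<in> topspace X" for x
    using continuous_map_image_subset_topspace[OF i] that by auto
  have "restrict g (topspace L) = restrict id (topspace L)"
  proof (rule ex1E[OF free_lcs_universal[OF free L i]])
    fix u
    assume "\<forall>v. v \<in> extensional (topspace L) \<and> continuous_linear L L v \<and>
      (\<forall>x\<in>topspace X. i x = v (i x)) \<longrightarrow> v = u"
    moreover have "continuous_linear L L id" by (simp add: continuous_linear_def linear_on_set_def)
    ultimately show ?thesis
      using continuous_linear_restrict[OF L gL] continuous_linear_restrict[OF L, of L id] g(2) iL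
      by (metis (no_types, lifting) id_apply restrict_apply' restrict_extensional)
  qed
  then have geq: "g y = y" if "y \<in> topspace L" for y using that by (metis id_apply restrict_apply')
  have "g ` topspace L \<subseteq> ?S"
    using g(1) continuous_map_image_subset_topspace[of L M g] topM by (auto simp: continuous_linear_def)
  then show "topspace L \<subseteq> ?S" using geq by force
qed

lemma span_image_combination:
  assumes "y \<in> span (i ` T)"
  obtains a :: "'a \<Rightarrow> real" where "finite {x. a x \<noteq> 0}" "{x. a x \<noteq> 0} \<subseteq> T" "y = (\<Sum>x | a x \<noteq> 0. a x *\<^sub>R i x)"
proof -
  obtain t r where t: "finite t" "t \<subseteq> i ` T" "y = (\<Sum>v\<in>t. r v *\<^sub>R v)"
    using assms unfolding span_explicit by blast
  define j where "j = inv_into T i"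
  have ij: "i (j v) = v" "j v \<in> T" if "v \<in> t" for v
    using t(2) that by (auto simp: j_def f_inv_into_f inv_into_into)
  have inj: "inj_on j t" using ij(1) by (rule inj_on_inverseI)
  define a where "a x = (if x \<in> j ` t then r (i x) else 0)" for x
  have supp: "{x. a x \<noteq> 0} \<subseteq> j ` t" by (auto simp: a_def)
  have "(\<Sum>x | a x \<noteq> 0. a x *\<^sub>R i x) = (\<Sum>x\<in>j ` t. a x *\<^sub>R i x)"
    using t(1) supp by (intro sum.mono_neutral_left) auto
  also have "\<dots> = (\<Sum>v\<in>t. a (j v) *\<^sub>R i (j v))" by (simp add: sum.reindex[OF inj])
  also have "\<dots> = y" unfolding t(3) by (rule sum.cong) (auto simp: a_def ij)
  finally show ?thesis
    using supp t(1) ij(2) by (intro that[of a]) (auto intro: finite_subset)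
qed

text \<open>
  Coefficient functions are chosen for the elements of \<open>B\<close>; pairing them with a continuous function
  is applying the corresponding functional, so all these pairings are bounded. This makes the
  union \<open>S\<close> of the supports functionally bounded, hence finite; pairing with functions that isolate
  a point of \<open>S\<close> then bounds the coefficients at this point.
\<close>
lemma free_lcs_bounded_finite_dimensional:
  fixes X :: "'a topology"
  assumes X: "Tychonoff_space X" "mu_space X" and free: "free_lcs X L i"
    and cpt: "\<forall>K. compactin X K \<longrightarrow> finite K" and B: "lcs_bounded L B"
  shows "\<exists>S C. finite S \<and> S \<subseteq> topspace X \<and>
    (\<forall>y\<in>B. \<exists>a. y = (\<Sum>x\<in>S. a x *\<^sub>R i x) \<and> (\<forall>x\<in>S. \<bar>a x\<bar> \<le> (C::real)))"
proof -
  have L: "lcs L" and i: "continuous_map X L i" using free by (auto simp: free_lcs_def)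
  have LS: "subspace (topspace L)" using L by (simp add: lcs_def)
  have iL: "i x \<in> topspace L" if "x \<in> topspace X" for x
    using continuous_map_image_subset_topspace[OF i] that by auto
  have "\<forall>y\<in>B. \<exists>a. finite {x. a x \<noteq> 0} \<and> {x. a x \<noteq> 0} \<subseteq> topspace X \<and>
      y = (\<Sum>x | a x \<noteq> 0. a x *\<^sub>R i x)"
  proof
    fix y assume "y \<in> B"
    moreover
    have "B \<subseteq> topspace L" using B unfolding lcs_bounded_def by (rule conjunct1)
    ultimately have "y \<in> span (i ` topspace X)" using free_lcs_span[OF free] by blast
    then show "\<exists>a. finite {x. a x \<noteq> 0} \<and> {x. a x \<noteq> 0} \<subseteq> topspace X \<and>
      y = (\<Sum>x | a x \<noteq> 0. a x *\<^sub>R i x)" by (rule span_image_combination) blast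
  qed
  from bchoice[OF this] obtain a where a: "\<And>y. y \<in> B \<Longrightarrow> finite {x. a y x \<noteq> 0}"
    "\<And>y. y \<in> B \<Longrightarrow> {x. a y x \<noteq> 0} \<subseteq> topspace X"
    "\<And>y. y \<in> B \<Longrightarrow> y = (\<Sum>x | a y x \<noteq> 0. a y x *\<^sub>R i x)"
    by blast
  have bnd: "bounded ((\<lambda>y. pairing (a y) f) ` B)" if f: "continuous_map X euclideanreal f" for f
  proof -
    from free_lcs_extend[OF free f] obtain \<phi> where
      \<phi>: "\<phi> \<in> dual_space L" "\<forall>x\<in>topspace X. \<phi> (i x) = f x" ..
    have lin: "linear_on_set (topspace L) \<phi>" using \<phi>(1) by (simp add: dual_space_def continuous_linear_def)
    have "pairing (a y) f = \<phi> y" if y: "y \<in> B" for y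
    proof -
      have "\<phi> y = \<phi> (\<Sum>x | a y x \<noteq> 0. a y x *\<^sub>R i x)" using a(3)[OF y] by (rule arg_cong)
      also have "\<dots> = (\<Sum>x | a y x \<noteq> 0. a y x *\<^sub>R \<phi> (i x))"
        using a(2)[OF y] by (intro linear_on_set_sum[OF LS lin] iL) auto
      also have "\<dots> = pairing (a y) f"
        unfolding pairing_def using a(2)[OF y] \<phi>(2) by (intro sum.cong) auto
      finally show ?thesis ..
    qed
    then have "(\<lambda>y. pairing (a y) f) ` B = \<phi> ` B" by (intro image_cong) auto
    then show ?thesis using dual_space_bounded_image[OF B \<phi>(1) L] by simp
  qed
  define S where "S = (\<Union>b\<in>a ` B. {x. b x \<noteq> 0})"
  have "functionally_bounded_in X S"
    unfolding S_def using a(1,2) bnd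
    by (intro functionally_bounded_support[OF X(1)]) (auto simp: image_image)
  then have SX: "S \<subseteq> topspace X" and "compactin X (X closure_of S)"
    using X(2) by (auto simp: functionally_bounded_in_def mu_space_def)
  then have S: "finite S" using cpt closure_of_subset[OF SX] finite_subset by blast
  have "\<exists>C. \<forall>y\<in>B. \<bar>a y x\<bar> \<le> C" if x: "x \<in> S" for x
  proof -
    have "closedin X (S - {x})"
      using X(1) S SX by (intro closedin_Hausdorff_finite) (auto simp: Tychonoff_space_def)
    then have "openin X (topspace X - (S - {x}))" by (rule openin_diff[OF openin_topspace])
    then obtain h where h: "continuous_map X euclideanreal h" "h x = 1"
      "\<And>z. z \<in> topspace X \<Longrightarrow> z \<notin> topspace X - (S - {x}) \<Longrightarrow> h z = 0"
      by (rule Tychonoff_bump[OF X(1), of _ x]) (use x SX in auto)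
    have "pairing (a y) h = a y x" if y: "y \<in> B" for y
    proof -
      have "h z = 0" if "a y z \<noteq> 0" "z \<noteq> x" for z
        using h(3)[of z] that y a(2)[OF y] unfolding S_def by blast
      then show ?thesis using pairing_single[OF a(1)[OF y], of x h] h(2) by simp
    qed
    then show ?thesis using bnd[OF h(1)] by (auto simp: bounded_iff)
  qed
  then obtain C where C: "\<And>x y. x \<in> S \<Longrightarrow> y \<in> B \<Longrightarrow> \<bar>a y x\<bar> \<le> C x" by metis
  show ?thesis
  proof (intro exI[of _ S] exI[of _ "\<Sum>x\<in>S. \<bar>C x\<bar>"] conjI ballI S SX)
    fix y assume y: "y \<in> B"
    show "\<exists>c. y = (\<Sum>x\<in>S. c x *\<^sub>R i x) \<and> (\<forall>x\<in>S. \<bar>c x\<bar> \<le> (\<Sum>x\<in>S. \<bar>C x\<bar>))"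
    proof (intro exI[of _ "a y"] conjI ballI)
      show "y = (\<Sum>x\<in>S. a y x *\<^sub>R i x)"
      proof -
        have "(\<Sum>x | a y x \<noteq> 0. a y x *\<^sub>R i x) = (\<Sum>x\<in>S. a y x *\<^sub>R i x)"
          using S y by (intro sum.mono_neutral_left) (auto simp: S_def)
        then show ?thesis using a(3)[OF y] by simp
      qed
      fix x assume x: "x \<in> S"
      have "\<bar>C x\<bar> \<le> (\<Sum>x\<in>S. \<bar>C x\<bar>)" using x S by (intro member_le_sum) auto
      then show "\<bar>a y x\<bar> \<le> (\<Sum>x\<in>S. \<bar>C x\<bar>)" using C[OF x y] by simp
    qed
  qed
qed

lemma limitin_weak_star_topology:
  assumes "lcs L" "\<And>n. \<phi> n \<in> dual_space L"
  shows "limitin (weak_star_topology L) \<phi> l F \<longleftrightarrow>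
    l \<in> dual_space L \<and> (\<forall>y\<in>topspace L. ((\<lambda>n. \<phi> n y) \<longlongrightarrow> l y) F)"
proof -
  have "(\<lambda>x \<phi>. \<phi> x) ` topspace L \<noteq> {}" using assms(1) by (auto simp: lcs_def dest: subspace_0)
  then show ?thesis
    unfolding weak_star_topology_def using assms(2) by (simp add: limitin_initial_topology)
qed

section \<open>The two implications\<close>

text \<open>
  On a bounded set, convergence at the finitely many points that span it is uniform, so weak-*
  convergence is already convergence in the strong topology.
\<close>
lemma Grothendieck_if_compact_finite:
  assumes X: "Tychonoff_space X" "mu_space X" and free: "free_lcs X L i"
    and cpt: "\<forall>K. compactin X K \<longrightarrow> finite K"
  shows "Grothendieck_property L"
  unfolding Grothendieck_property_def
proof (intro allI impI, elim conjE exE)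
  fix \<phi> :: "nat \<Rightarrow> 'b \<Rightarrow> real" and l
  assume \<phi>: "range \<phi> \<subseteq> dual_space L" and lim: "limitin (weak_star_topology L) \<phi> l sequentially"
  have L: "lcs L" and i: "continuous_map X L i" using free by (auto simp: free_lcs_def)
  have LS: "subspace (topspace L)" using L by (simp add: lcs_def)
  have \<phi>n: "\<phi> n \<in> dual_space L" for n using \<phi> by blast
  have l: "l \<in> dual_space L" and pt: "\<And>y. y \<in> topspace L \<Longrightarrow> (\<lambda>n. \<phi> n y) \<longlonglongrightarrow> l y"
    using lim unfolding limitin_weak_star_topology[OF L \<phi>n] by blast+
  have "uniform_limit B \<phi> l sequentially" if B: "lcs_bounded L B" for B
  proof -
    obtain S C where S: "finite S" "S \<subseteq> topspace X"
      and a: "\<forall>y\<in>B. \<exists>a. y = (\<Sum>x\<in>S. a x *\<^sub>R i x) \<and> (\<forall>x\<in>S. \<bar>a x\<bar> \<le> C)"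
      using free_lcs_bounded_finite_dimensional[OF X free cpt B] by (elim exE conjE) (rule that)
    have iL: "i x \<in> topspace L" if "x \<in> S" for x
      using continuous_map_image_subset_topspace[OF i] that S(2) by auto
    have "(\<lambda>n. \<Sum>x\<in>S. C * \<bar>\<phi> n (i x) - l (i x)\<bar>) \<longlonglongrightarrow> (\<Sum>x\<in>S. C * \<bar>l (i x) - l (i x)\<bar>)"
      by (intro tendsto_intros pt iL)
    then have "(\<lambda>n. \<Sum>x\<in>S. C * \<bar>\<phi> n (i x) - l (i x)\<bar>) \<longlonglongrightarrow> 0" by simp
    moreover have "\<bar>\<phi> n y - l y\<bar> \<le> (\<Sum>x\<in>S. C * \<bar>\<phi> n (i x) - l (i x)\<bar>)" if y: "y \<in> B" for n y
    proof -
      from bspec[OF a y] obtain c where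
        c: "y = (\<Sum>x\<in>S. c x *\<^sub>R i x) \<and> (\<forall>x\<in>S. \<bar>c x\<bar> \<le> C)" ..
      have eval: "\<psi> y = (\<Sum>x\<in>S. c x * \<psi> (i x))" if "\<psi> \<in> dual_space L" for \<psi>
      proof -
        have "linear_on_set (topspace L) \<psi>" using that by (simp add: dual_space_def continuous_linear_def)
        then have "\<psi> (\<Sum>x\<in>S. c x *\<^sub>R i x) = (\<Sum>x\<in>S. c x *\<^sub>R \<psi> (i x))"
          by (rule linear_on_set_sum[OF LS]) (rule iL)
        then show ?thesis using c by simp
      qed
      have "\<phi> n y - l y = (\<Sum>x\<in>S. c x * (\<phi> n (i x) - l (i x)))"
        by (simp add: eval[OF \<phi>n] eval[OF l] right_diff_distrib sum_subtractf)
      also have "\<bar>\<dots>\<bar> \<le> (\<Sum>x\<in>S. \<bar>c x * (\<phi> n (i x) - l (i x))\<bar>)" by (rule sum_abs)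
      also have "\<dots> \<le> (\<Sum>x\<in>S. C * \<bar>\<phi> n (i x) - l (i x)\<bar>)"
        using c by (intro sum_mono) (auto simp: abs_mult intro: mult_right_mono)
      finally show ?thesis .
    qed
    ultimately show ?thesis
      by (intro uniform_limitI) (auto simp: dist_real_def dest!: order_tendstoD(2)
          elim!: eventually_mono intro: le_less_trans)
  qed
  then have "limitin (strong_dual L) \<phi> l sequentially" using l \<phi> by (intro strong_dual_limitI) auto
  then show "\<exists>l. limitin (weak_topology (strong_dual L)) \<phi> l sequentially"
    using limitin_imp_limitin_weak_topology by blast
qed

text \<open>
  The sequence \<open>\<phi> n\<close> extends \<open>2 ^ n * f n\<close> for bumps \<open>f n\<close> with disjoint supports, and \<open>\<theta>\<close> is the sum
  of the evaluations at \<open>i (x k)\<close> with weights \<open>(1/2) ^ k\<close>. The factors \<open>2 ^ n\<close> cancel these weights,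
  so \<open>\<theta>\<close> stays away from \<open>0\<close> along a sequence that tends to \<open>0\<close> weak-*.
\<close>
lemma not_Grothendieck_if_disjoint_bumps:
  fixes X :: "'a topology" and L :: "'l::real_vector topology"
    and x :: "nat \<Rightarrow> 'a" and f :: "nat \<Rightarrow> 'a \<Rightarrow> real"
  assumes free: "free_lcs X L i" and K: "compactin X K" and x: "\<And>n. x n \<in> K"
    and f: "\<And>n. continuous_map X euclideanreal (f n)" and f1: "\<And>n. f n (x n) = 1"
    and disj: "\<And>m n z. z \<in> topspace X \<Longrightarrow> m \<noteq> n \<Longrightarrow> f m z = 0 \<or> f n z = 0"
  shows "\<not> Grothendieck_property L"
proof
  assume G: "Grothendieck_property L"
  have L: "lcs L" and i: "continuous_map X L i" using free by (auto simp: free_lcs_def)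
  have LS: "subspace (topspace L)" using L by (simp add: lcs_def)
  have KX: "K \<subseteq> topspace X" by (rule compactin_subset_topspace[OF K])
  have iL: "i x \<in> topspace L" if "x \<in> topspace X" for x
    using continuous_map_image_subset_topspace[OF i] that by auto
  have "\<forall>n. \<exists>\<psi>\<in>dual_space L. \<forall>z\<in>topspace X. \<psi> (i z) = 2 ^ n * f n z"
    by (intro allI free_lcs_extend[OF free] continuous_map_real_mult_left f)
  from this[unfolded Bex_def, THEN choice] obtain \<phi> where \<phi>: "\<And>n. \<phi> n \<in> dual_space L"
    "\<And>n z. z \<in> topspace X \<Longrightarrow> \<phi> n (i z) = 2 ^ n * f n z"
    by blast
  have pt: "eventually (\<lambda>n. \<phi> n (i z) = 0) sequentially" if z: "z \<in> topspace X" for z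
  proof (cases "\<exists>m. f m z \<noteq> 0")
    case True
    then obtain m where "f m z \<noteq> 0" by blast
    then have "\<phi> n (i z) = 0" if "n > m" for n using disj[OF z, of m n] that \<phi>(2)[OF z] by auto
    then show ?thesis by (intro eventually_mono[OF eventually_gt_at_top[of m]])
  qed (simp add: \<phi>(2)[OF z])
  have "(\<lambda>n. \<phi> n y) \<longlonglongrightarrow> 0" if "y \<in> topspace L" for y
  proof -
    have "y \<in> span (i ` topspace X)" using that free_lcs_span[OF free] by simp
    then obtain a where a: "finite {z. a z \<noteq> 0}" "{z. a z \<noteq> 0} \<subseteq> topspace X"
      "y = (\<Sum>z | a z \<noteq> 0. a z *\<^sub>R i z)" by (rule span_image_combination)
    have "eventually (\<lambda>n. \<forall>z\<in>{z. a z \<noteq> 0}. \<phi> n (i z) = 0) sequentially"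
      using a pt by (intro eventually_ball_finite) auto
    then have "eventually (\<lambda>n. \<phi> n y = 0) sequentially"
    proof (rule eventually_mono)
      fix n assume *: "\<forall>z\<in>{z. a z \<noteq> 0}. \<phi> n (i z) = 0"
      have "linear_on_set (topspace L) (\<phi> n)"
        using \<phi>(1)[of n] by (simp add: dual_space_def continuous_linear_def)
      then have "\<phi> n y = (\<Sum>z | a z \<noteq> 0. a z *\<^sub>R \<phi> n (i z))"
        unfolding a(3) using a(2) by (intro linear_on_set_sum[OF LS] iL) auto
      then show "\<phi> n y = 0" using * by simp
    qed
    then show ?thesis by (rule tendsto_eventually)
  qed
  then have "limitin (weak_star_topology L) \<phi> 0 sequentially"
    using limitin_weak_star_topology[OF L, of \<phi> 0 sequentially] \<phi>(1) zero_in_dual_space by auto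
  then obtain l where l: "limitin (weak_topology (strong_dual L)) \<phi> l sequentially"
    using G \<phi>(1) unfolding Grothendieck_property_def by blast
  have "dual_space (strong_dual L) \<noteq> {}" using zero_in_dual_space by blast
  note l[unfolded weak_topology_def topspace_strong_dual limitin_initial_topology[OF this]]
  then have lD: "l \<in> dual_space L"
    and weak: "\<And>\<theta>. \<theta> \<in> dual_space (strong_dual L) \<Longrightarrow> (\<lambda>n. \<theta> (\<phi> n)) \<longlonglongrightarrow> \<theta> l"
    by blast+
  define D where "D = dual_space L"
  have D: "subspace D" unfolding D_def by (rule subspace_dual_space[OF L])
  have Kbdd: "lcs_bounded L (i ` K)"
    by (rule compactin_imp_lcs_bounded[OF L image_compactin[OF K i]])
  \<comment> \<open>The weak limit vanishes at the points \<open>i (x k)\<close>, since evaluation there belongs to the bidual.\<close>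
  have "(\<lambda>\<psi>. if \<psi> \<in> D then \<psi> (i (x k)) else 0) \<in> dual_space (strong_dual L)" for k
  proof (rule dual_space_strong_dualI[where C = 1, OF _ _ Kbdd])
    show "linear_on_set (dual_space L) (\<lambda>\<psi>. if \<psi> \<in> D then \<psi> (i (x k)) else 0)"
      unfolding linear_on_set_def D_def[symmetric]
    proof (intro conjI ballI allI)
      fix \<psi> \<psi>' assume "\<psi> \<in> D" "\<psi>' \<in> D"
      then show "(if \<psi> + \<psi>' \<in> D then (\<psi> + \<psi>') (i (x k)) else 0) =
          (if \<psi> \<in> D then \<psi> (i (x k)) else 0) + (if \<psi>' \<in> D then \<psi>' (i (x k)) else 0)"
        using subspace_add[OF D] by simp
    next
      fix c \<psi> assume "\<psi> \<in> D"
      then show "(if c *\<^sub>R \<psi> \<in> D then (c *\<^sub>R \<psi>) (i (x k)) else 0) =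
          c *\<^sub>R (if \<psi> \<in> D then \<psi> (i (x k)) else 0)"
        using subspace_scale[OF D, of \<psi> c] by (simp add: scaleR_fun_def)
    qed
    show "\<bar>(if \<psi>' \<in> D then \<psi>' (i (x k)) else 0) - (if \<psi> \<in> D then \<psi> (i (x k)) else 0)\<bar> \<le> 1 * \<delta>"
      if "\<psi> \<in> dual_space L" "\<psi>' \<in> dual_space L" "\<And>y. y \<in> i ` K \<Longrightarrow> \<bar>\<psi>' y - \<psi> y\<bar> < \<delta>" for \<psi> \<psi>' \<delta>
      using that(1,2) that(3)[OF imageI[OF x[of k]]] by (simp add: D_def)
  qed (simp_all add: D_def)
  from weak[OF this] have "(\<lambda>n. \<phi> n (i (x k))) \<longlonglongrightarrow> l (i (x k))" for k
    using \<phi>(1) lD by (simp add: D_def)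
  moreover have "(\<lambda>n. \<phi> n (i (x k))) \<longlonglongrightarrow> 0" for k
    using pt[of "x k"] x KX by (intro tendsto_eventually) auto
  ultimately have l0: "l (i (x k)) = 0" for k by (blast intro: LIMSEQ_unique)
  define \<theta> where "\<theta> \<psi> = (if \<psi> \<in> D then \<Sum>k. (1/2) ^ k * \<psi> (i (x k)) else 0)" for \<psi> :: "'l \<Rightarrow> real"
  have sm: "summable (\<lambda>k. (1/2) ^ k * \<psi> (i (x k)))" if "\<psi> \<in> D" for \<psi>
  proof -
    have "bounded (\<psi> ` i ` K)" using that dual_space_bounded_image[OF Kbdd _ L] by (simp add: D_def)
    then obtain C where "\<forall>v\<in>\<psi> ` i ` K. norm v \<le> C" unfolding bounded_iff ..
    then have C: "\<bar>\<psi> (i y)\<bar> \<le> C" if "y \<in> K" for y using that by simp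
    show ?thesis
    proof (rule summable_comparison_test')
      show "summable (\<lambda>k. (1/2) ^ k * C)" by (intro summable_mult2 summable_geometric) simp
      show "norm ((1/2) ^ k * \<psi> (i (x k))) \<le> (1/2) ^ k * C" for k
        using C[OF x] by (simp add: abs_mult mult_left_mono)
    qed
  qed
  have "\<theta> \<in> dual_space (strong_dual L)"
  proof (rule dual_space_strong_dualI[where C = 2, OF _ _ Kbdd])
    show "linear_on_set (dual_space L) \<theta>"
      unfolding linear_on_set_def D_def[symmetric]
    proof (intro conjI ballI allI)
      fix \<psi> \<psi>' assume *: "\<psi> \<in> D" "\<psi>' \<in> D"
      then show "\<theta> (\<psi> + \<psi>') = \<theta> \<psi> + \<theta> \<psi>'"
        using subspace_add[OF D *] by (simp add: \<theta>_def distrib_left suminf_add[OF sm sm])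
    next
      fix c \<psi> assume *: "\<psi> \<in> D"
      then show "\<theta> (c *\<^sub>R \<psi>) = c *\<^sub>R \<theta> \<psi>"
        using subspace_scale[OF D *, of c] suminf_mult[OF sm[OF *], of c]
        by (simp add: \<theta>_def scaleR_fun_def mult.left_commute)
    qed
    fix \<psi> \<psi>' :: "'l \<Rightarrow> real" and \<delta> :: real
    assume *: "\<psi> \<in> dual_space L" "\<psi>' \<in> dual_space L" "\<delta> > 0"
      "\<And>y. y \<in> i ` K \<Longrightarrow> \<bar>\<psi>' y - \<psi> y\<bar> < \<delta>"
    have "\<theta> \<psi>' - \<theta> \<psi> = (\<Sum>k. (1/2) ^ k * \<psi>' (i (x k)) - (1/2) ^ k * \<psi> (i (x k)))"
      using * sm by (simp add: \<theta>_def D_def suminf_diff)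
    also have "norm \<dots> \<le> (\<Sum>k. (1/2) ^ k * \<delta>)"
    proof (rule norm_suminf_le)
      show "summable (\<lambda>k. (1/2) ^ k * \<delta>)" by (intro summable_mult2 summable_geometric) simp
      show "norm ((1/2) ^ k * \<psi>' (i (x k)) - (1/2) ^ k * \<psi> (i (x k))) \<le> (1/2) ^ k * \<delta>" for k
      proof -
        have "\<bar>\<psi>' (i (x k)) - \<psi> (i (x k))\<bar> \<le> \<delta>" using *(4)[OF imageI[OF x[of k]]] by simp
        then show ?thesis by (simp add: right_diff_distrib[symmetric] abs_mult mult_left_mono)
      qed
    qed
    also have "\<dots> = 2 * \<delta>"
      using suminf_mult2[OF summable_geometric[of "1/2 :: real"], of \<delta>] suminf_geometric[of "1/2 :: real"]
      by simp
    finally show "\<bar>\<theta> \<psi>' - \<theta> \<psi>\<bar> \<le> 2 * \<delta>" by simp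
  qed (simp_all add: \<theta>_def D_def)
  from weak[OF this] have "(\<lambda>n. \<theta> (\<phi> n)) \<longlonglongrightarrow> \<theta> l" .
  moreover have "\<theta> l = 0" using lD by (simp add: \<theta>_def D_def l0)
  moreover have "\<theta> (\<phi> n) = 1" for n
  proof -
    have "(1/2) ^ k * \<phi> n (i (x k)) = (if k = n then 1 else 0)" for k
    proof -
      have xk: "x k \<in> topspace X" using x KX by blast
      show ?thesis
      proof (cases "k = n")
        case True
        then show ?thesis using \<phi>(2)[OF xk, of n] f1[of n] by (simp add: power_one_over)
      next
        case False
        then show ?thesis using \<phi>(2)[OF xk, of n] f1[of k] disj[OF xk, of k n] by simp
      qed
    qed
    then have "\<theta> (\<phi> n) = (\<Sum>k. if k = n then 1 else 0)" using \<phi>(1) by (simp add: \<theta>_def D_def)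
    also have "\<dots> = 1" using suminf_finite[of "{n}" "\<lambda>k. if k = n then 1 else (0::real)"] by simp
    finally show ?thesis .
  qed
  ultimately show False by (simp add: LIMSEQ_const_iff)
qed

lemma compact_finite_if_Grothendieck:
  assumes X: "Tychonoff_space X" and free: "free_lcs X L i" and G: "Grothendieck_property L"
    and K: "compactin X K"
  shows "finite K"
proof (rule ccontr)
  assume "infinite K"
  from disjoint_bumps_on_infinite_compact[OF X K this] show False
  proof (elim exE conjE)
    fix x :: "nat \<Rightarrow> 'a" and f :: "nat \<Rightarrow> 'a \<Rightarrow> real"
    assume xf: "\<forall>n. x n \<in> K \<and> continuous_map X euclideanreal (f n) \<and> f n (x n) = 1"
      and disj: "\<forall>z\<in>topspace X. \<forall>m n. m \<noteq> n \<longrightarrow> f m z = 0 \<or> f n z = 0"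
    have "\<not> Grothendieck_property L"
    proof (rule not_Grothendieck_if_disjoint_bumps[OF free K, where x = x and f = f])
      show "x n \<in> K" "continuous_map X euclideanreal (f n)" "f n (x n) = 1" for n
        using xf by simp_all
      show "f m z = 0 \<or> f n z = 0" if "z \<in> topspace X" "m \<noteq> n" for m n z
        using bspec[OF disj that(1)] that(2) by blast
    qed
    with G show False by simp
  qed
qed

theorem theorem1p5:
  fixes X :: "'a topology" and L :: "'l::real_vector topology" and i :: "'a \<Rightarrow> 'l"
  assumes "Tychonoff_space X" and "mu_space X" and "free_lcs X L i"
  shows "Grothendieck_property L \<longleftrightarrow> (\<forall>K. compactin X K \<longrightarrow> finite K)"
  using Grothendieck_if_compact_finite[OF assms] compact_finite_if_Grothendieck[OF assms(1,3)] by blast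

end
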